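(* Let $k\ge 2$ and $n\ge 1$ be integers and let $\phi\in L^\infty(\mathbb{T}^n)$. The $k^{th}$ order slant Hankel operator of level $n$, $\mathcal{S}_\phi^{k,n}$, on $L^2(\mathbb{T}^n)$ is hyponormal if and only if $\phi=0$.
   Context: $\mathbb{T}^n$ is the $n$-torus with normalized Haar measure; $e_m(z)=z^m=z_1^{m_1}\cdots z_n^{m_n}$ for $m\in\mathbb{Z}^n$, an orthonormal basis of $L^2(\mathbb{T}^n)$. For $m\in\mathbb{Z}^n$, $k\mid m$ means $k$ divides every component of $m$. Let $\mathcal{V}_k^n$ be the bounded linear operator on $L^2(\mathbb{T}^n)$ with $\mathcal{V}_k^n e_m=e_{-m/k}$ if $k\mid m$ and $\mathcal{V}_k^n e_m=0$ otherwise. For $\phi\in L^\infty(\mathbb{T}^n)$, $M_\phi$ is multiplication by $\phi$ and $\mathcal{S}_\phi^{k,n}=\mathcal{V}_k^nM_\phi$. A bounded operator $T$ is hyponormal if $\|Tf\|\ge\|T^*f\|$ for all $f$. *)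

theory Defs
  imports "HOL-Probability.Probability"
begin

text \<open>
  The index type \<open>'n\<close> plays the role of \<open>{1, \<dots>, n}\<close>, so that \<open>n = CARD('n)\<close> is an arbitrary
  positive integer.
\<close>

text \<open>
  Normalized arc length on the unit circle. The product of \<open>n\<close> copies of it is the normalized Haar
  measure on the torus. Values of functions off the torus play no role, because functions are
  identified below when they agree almost everywhere with respect to \<open>torus\<close>.
\<close>

definition circle :: "complex measure" where
  "circle = distr (uniform_measure lborel {0..<2 * pi}) (restrict_space borel (sphere 0 1)) cis"

definition torus :: "('n::finite \<Rightarrow> complex) measure" where
  "torus = PiM UNIV (\<lambda>_. circle)"

lemma prob_space_circle: "prob_space circle"
proof -
  have "prob_space (uniform_measure lborel {0..<2 * pi})"
    by (rule prob_space_uniform_measure) auto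
  moreover have "cis \<in> measurable (uniform_measure lborel {0..<2 * pi}) (restrict_space borel (sphere 0 1))"
    by (intro measurable_restrict_space2)
       (auto simp: measurable_cong_sets[OF sets_uniform_measure refl]
         intro!: borel_measurable_continuous_onI continuous_intros)
  ultimately show ?thesis
    unfolding circle_def by (rule prob_space.prob_space_distr)
qed

lemma prob_space_torus: "prob_space (torus :: ('n::finite \<Rightarrow> complex) measure)"
  unfolding torus_def by (rule prob_space_PiM) (rule prob_space_circle)

lemma space_torus: "space (torus :: ('n::finite \<Rightarrow> complex) measure) = {z. \<forall>i. cmod (z i) = 1}"
  by (auto simp: torus_def circle_def space_PiM space_restrict_space PiE_def Pi_def)

lemma measurable_torus_component [measurable]:
  "(\<lambda>z. z i) \<in> borel_measurable (torus :: ('n::finite \<Rightarrow> complex) measure)"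
proof -
  have "(\<lambda>z. z i) \<in> measurable (torus :: ('n \<Rightarrow> complex) measure) circle"
    unfolding torus_def by measurable
  moreover have "(\<lambda>z. z) \<in> borel_measurable circle"
    unfolding circle_def by (simp add: measurable_restrict_space1)
  ultimately show ?thesis
    by (rule measurable_compose)
qed

definition square_integrable :: "(('n::finite \<Rightarrow> complex) \<Rightarrow> complex) \<Rightarrow> bool" where
  "square_integrable f \<longleftrightarrow>
     f \<in> borel_measurable torus \<and> integrable torus (\<lambda>z. (cmod (f z))\<^sup>2)"

definition essentially_bounded :: "(('n::finite \<Rightarrow> complex) \<Rightarrow> complex) \<Rightarrow> bool" where
  "essentially_bounded f \<longleftrightarrow>
     f \<in> borel_measurable torus \<and> (\<exists>C. AE z in torus. cmod (f z) \<le> C)"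

lemma square_integrable_zero: "square_integrable (\<lambda>_. 0)"
  by (simp add: square_integrable_def)

lemma essentially_bounded_zero: "essentially_bounded (\<lambda>_. 0)"
  by (auto simp: essentially_bounded_def)

lemma square_integrable_add:
  assumes "square_integrable f" "square_integrable g"
  shows "square_integrable (\<lambda>z. f z + g z)"
proof -
  have [measurable]: "f \<in> borel_measurable torus" "g \<in> borel_measurable torus"
    using assms by (auto simp: square_integrable_def)
  have "integrable torus (\<lambda>z. (cmod (f z + g z))\<^sup>2)"
  proof (rule Bochner_Integration.integrable_bound)
    show "integrable torus (\<lambda>z. 2 * (cmod (f z))\<^sup>2 + 2 * (cmod (g z))\<^sup>2)"
      using assms by (auto simp: square_integrable_def)
    have "(cmod (a + b))\<^sup>2 \<le> 2 * (cmod a)\<^sup>2 + 2 * (cmod b)\<^sup>2" for a b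
    proof -
      have "(cmod (a + b))\<^sup>2 \<le> (cmod a + cmod b)\<^sup>2"
        by (simp add: norm_triangle_ineq power_mono)
      also have "\<dots> \<le> 2 * (cmod a)\<^sup>2 + 2 * (cmod b)\<^sup>2"
        using sum_squares_bound[of "cmod a" "cmod b"] by (simp add: power2_sum)
      finally show ?thesis .
    qed
    then show "AE z in torus. norm ((cmod (f z + g z))\<^sup>2)
                 \<le> norm (2 * (cmod (f z))\<^sup>2 + 2 * (cmod (g z))\<^sup>2)"
      by simp
  qed measurable
  then show ?thesis
    by (simp add: square_integrable_def)
qed

lemma square_integrable_mult:
  assumes "essentially_bounded p" "square_integrable f"
  shows "square_integrable (\<lambda>z. p z * f z)"
proof -
  have [measurable]: "f \<in> borel_measurable torus" "p \<in> borel_measurable torus"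
    using assms by (auto simp: square_integrable_def essentially_bounded_def)
  obtain C where C: "AE z in torus. cmod (p z) \<le> C"
    using assms by (auto simp: essentially_bounded_def)
  have "integrable torus (\<lambda>z. (cmod (p z * f z))\<^sup>2)"
  proof (rule Bochner_Integration.integrable_bound)
    show "integrable torus (\<lambda>z. C\<^sup>2 * (cmod (f z))\<^sup>2)"
      using assms by (auto simp: square_integrable_def)
    show "AE z in torus. norm ((cmod (p z * f z))\<^sup>2) \<le> norm (C\<^sup>2 * (cmod (f z))\<^sup>2)"
      using C
    proof eventually_elim
      case (elim z)
      then have "(cmod (p z))\<^sup>2 \<le> C\<^sup>2"
        by (simp add: power_mono)
      then show ?case
        by (simp add: norm_mult power_mult_distrib mult_right_mono)
    qed
  qed measurable
  then show ?thesis
    by (simp add: square_integrable_def)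
qed

lemma square_integrable_cmult:
  assumes "square_integrable f"
  shows "square_integrable (\<lambda>z. c * f z)"
  by (rule square_integrable_mult[OF _ assms]) (auto simp: essentially_bounded_def)

lemma integrable_mult_cnj:
  assumes "square_integrable f" "square_integrable g"
  shows "integrable torus (\<lambda>z. f z * cnj (g z))"
proof (rule Bochner_Integration.integrable_bound)
  have [measurable]: "f \<in> borel_measurable torus" "g \<in> borel_measurable torus"
    using assms by (auto simp: square_integrable_def)
  show "integrable torus (\<lambda>z. (cmod (f z))\<^sup>2 + (cmod (g z))\<^sup>2)"
    using assms by (auto simp: square_integrable_def)
  show "(\<lambda>z. f z * cnj (g z)) \<in> borel_measurable torus"
    by (intro borel_measurable_times borel_measurable_continuous_on[of cnj])
       (auto intro!: continuous_intros)
  have "cmod a * cmod b \<le> (cmod a)\<^sup>2 + (cmod b)\<^sup>2" for a b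
  proof -
    have "0 \<le> cmod a * cmod b"
      by simp
    then show ?thesis
      using sum_squares_bound[of "cmod a" "cmod b"] by linarith
  qed
  then show "AE z in torus. norm (f z * cnj (g z)) \<le> norm ((cmod (f z))\<^sup>2 + (cmod (g z))\<^sup>2)"
    by (simp add: norm_mult)
qed

quotient_type (overloaded) 'n L2 = "('n::finite \<Rightarrow> complex) \<Rightarrow> complex" /
  partial: "\<lambda>f g. square_integrable f \<and> square_integrable g \<and> (AE z in torus. f z = g z)"
proof (rule part_equivpI)
  show "\<exists>f :: ('n \<Rightarrow> complex) \<Rightarrow> complex. square_integrable f \<and> square_integrable f \<and> (AE z in torus. f z = f z)"
    using square_integrable_zero by auto
qed (auto intro!: sympI transpI)

quotient_type (overloaded) 'n Linf = "('n::finite \<Rightarrow> complex) \<Rightarrow> complex" /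
  partial: "\<lambda>f g. essentially_bounded f \<and> essentially_bounded g \<and> (AE z in torus. f z = g z)"
proof (rule part_equivpI)
  show "\<exists>f :: ('n \<Rightarrow> complex) \<Rightarrow> complex. essentially_bounded f \<and> essentially_bounded f \<and> (AE z in torus. f z = f z)"
    using essentially_bounded_zero by auto
qed (auto intro!: sympI transpI)

instantiation Linf :: (finite) zero
begin

lift_definition zero_Linf :: "'a Linf" is "\<lambda>_. 0"
  by (simp add: essentially_bounded_zero)

instance ..

end

lift_definition scaleC :: "complex \<Rightarrow> 'n::finite L2 \<Rightarrow> 'n L2" is "\<lambda>c f z. c * f z"
  by (auto intro: square_integrable_cmult)

text \<open>The inner product is linear in its first argument.\<close>

lift_definition cinner :: "'n::finite L2 \<Rightarrow> 'n L2 \<Rightarrow> complex" is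
  "\<lambda>f g. \<integral>z. f z * cnj (g z) \<partial>torus"
proof -
  fix f f' g g' :: "('n \<Rightarrow> complex) \<Rightarrow> complex"
  assume f: "square_integrable f \<and> square_integrable f' \<and> (AE z in torus. f z = f' z)"
    and g: "square_integrable g \<and> square_integrable g' \<and> (AE z in torus. g z = g' z)"
  have "AE z in torus. f z * cnj (g z) = f' z * cnj (g' z)"
    using f[THEN conjunct2, THEN conjunct2] g[THEN conjunct2, THEN conjunct2] by eventually_elim simp
  then show "(\<integral>z. f z * cnj (g z) \<partial>torus) = (\<integral>z. f' z * cnj (g' z) \<partial>torus)"
    using f g by (intro integral_cong_AE) (auto intro!: borel_measurable_integrable integrable_mult_cnj)
qed

instantiation L2 :: (finite) real_inner
begin

lift_definition zero_L2 :: "'a L2" is "\<lambda>_. 0"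
  by (simp add: square_integrable_zero)

lift_definition plus_L2 :: "'a L2 \<Rightarrow> 'a L2 \<Rightarrow> 'a L2" is "\<lambda>f g z. f z + g z"
  by (auto intro: square_integrable_add)

definition scaleR_L2 :: "real \<Rightarrow> 'a L2 \<Rightarrow> 'a L2" where
  "scaleR_L2 r f = scaleC (of_real r) f"

definition uminus_L2 :: "'a L2 \<Rightarrow> 'a L2" where
  "uminus_L2 f = scaleC (-1) f"

definition minus_L2 :: "'a L2 \<Rightarrow> 'a L2 \<Rightarrow> 'a L2" where
  "minus_L2 f g = f + - g"

definition inner_L2 :: "'a L2 \<Rightarrow> 'a L2 \<Rightarrow> real" where
  "inner_L2 f g = Re (cinner f g)"

definition norm_L2 :: "'a L2 \<Rightarrow> real" where
  "norm_L2 f = sqrt (Re (cinner f f))"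

definition sgn_L2 :: "'a L2 \<Rightarrow> 'a L2" where
  "sgn_L2 f = inverse (norm f) *\<^sub>R f"

definition dist_L2 :: "'a L2 \<Rightarrow> 'a L2 \<Rightarrow> real" where
  "dist_L2 f g = norm (f - g)"

definition uniformity_L2 :: "('a L2 \<times> 'a L2) filter" where
  "uniformity_L2 = (INF e\<in>{0 <..}. principal {(x, y). dist x y < e})"

definition open_L2 :: "'a L2 set \<Rightarrow> bool" where
  "open_L2 U \<longleftrightarrow> (\<forall>x\<in>U. eventually (\<lambda>(x', y). x' = x \<longrightarrow> y \<in> U) uniformity)"

instance
proof
  fix f g h :: "'a L2" and r s :: real
  show "f + g + h = f + (g + h)"
    by transfer (auto simp: add.assoc intro!: square_integrable_add)
  show "f + g = g + f"
    by transfer (auto simp: add.commute intro!: square_integrable_add)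
  show "0 + f = f"
    by transfer auto
  show "- f + f = 0"
    unfolding uminus_L2_def
    by transfer (use square_integrable_zero in auto)
  show "f - g = f + - g"
    by (rule minus_L2_def)
  show "r *\<^sub>R (f + g) = r *\<^sub>R f + r *\<^sub>R g"
    unfolding scaleR_L2_def
    by transfer (auto simp: distrib_left intro!: square_integrable_add square_integrable_cmult)
  show "(r + s) *\<^sub>R f = r *\<^sub>R f + s *\<^sub>R f"
    unfolding scaleR_L2_def
    by transfer (auto simp: distrib_right intro!: square_integrable_add square_integrable_cmult)
  show "r *\<^sub>R s *\<^sub>R f = (r * s) *\<^sub>R f"
    unfolding scaleR_L2_def
    by transfer (auto simp: mult.assoc intro!: square_integrable_cmult)
  show "1 *\<^sub>R f = f"
    unfolding scaleR_L2_def by transfer auto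
  show "sgn f = inverse (norm f) *\<^sub>R f"
    by (rule sgn_L2_def)
  show "dist f g = norm (f - g)"
    by (rule dist_L2_def)
  show "uniformity = (INF e\<in>{0 <..}. principal {(x :: 'a L2, y). dist x y < e})"
    by (rule uniformity_L2_def)
  show "open U \<longleftrightarrow> (\<forall>x\<in>U. eventually (\<lambda>(x', y). x' = x \<longrightarrow> y \<in> U) uniformity)" for U :: "'a L2 set"
    by (rule open_L2_def)
  have cnj_cinner: "cinner g f = cnj (cinner f g)"
  proof (transfer, goal_cases)
    case (1 g f)
    have "(\<integral>z. g z * cnj (f z) \<partial>torus) = (\<integral>z. cnj (f z * cnj (g z)) \<partial>torus)"
      by (simp add: mult.commute)
    then show ?case
      by (simp only: Bochner_Integration.integral_cnj)
  qed
  then show "inner f g = inner g f"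
    by (simp add: inner_L2_def)
  have "cinner (f + g) h = cinner f h + cinner g h"
    by transfer (simp add: distrib_right integrable_mult_cnj)
  then show "inner (f + g) h = inner f h + inner g h"
    by (simp add: inner_L2_def)
  have "cinner (scaleC c f) g = c * cinner f g" for c
    by transfer (simp add: mult.assoc)
  then show "inner (r *\<^sub>R f) g = r * inner f g"
    by (simp add: inner_L2_def scaleR_L2_def)
  have cinner_self: "Re (cinner f f) \<ge> 0 \<and> (Re (cinner f f) = 0 \<longleftrightarrow> f = 0)"
  proof (transfer, goal_cases)
    case (1 f)
    have "(\<integral>z. f z * cnj (f z) \<partial>torus) = (\<integral>z. of_real ((cmod (f z))\<^sup>2) \<partial>torus)"
      by (simp flip: complex_norm_square)
    also have "\<dots> = of_real (\<integral>z. (cmod (f z))\<^sup>2 \<partial>torus)"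
      by (rule integral_complex_of_real)
    finally have "Re (\<integral>z. f z * cnj (f z) \<partial>torus) = (\<integral>z. (cmod (f z))\<^sup>2 \<partial>torus)"
      by simp
    moreover have "(\<integral>z. (cmod (f z))\<^sup>2 \<partial>torus) = 0 \<longleftrightarrow> (AE z in torus. (cmod (f z))\<^sup>2 = 0)"
      using 1 by (intro integral_nonneg_eq_0_iff_AE) (auto simp: square_integrable_def)
    ultimately show ?case
      using 1 square_integrable_zero by (auto intro!: integral_nonneg_AE)
  qed
  then show "0 \<le> inner f f" "inner f f = 0 \<longleftrightarrow> f = 0"
    by (auto simp: inner_L2_def)
  show "norm f = sqrt (inner f f)"
    by (simp add: norm_L2_def inner_L2_def)
qed

end

lift_definition monomial :: "('n::finite \<Rightarrow> int) \<Rightarrow> 'n L2" is "\<lambda>m z. \<Prod>i\<in>UNIV. z i powi m i"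
proof -
  fix m :: "'n \<Rightarrow> int"
  interpret prob_space "torus :: ('n \<Rightarrow> complex) measure"
    by (rule prob_space_torus)
  have [measurable]: "(\<lambda>z. \<Prod>i\<in>UNIV. z i powi m i) \<in> borel_measurable (torus :: ('n \<Rightarrow> complex) measure)"
    unfolding power_int_def by measurable
  have "integrable (torus :: ('n \<Rightarrow> complex) measure) (\<lambda>z. (cmod (\<Prod>i\<in>UNIV. z i powi m i))\<^sup>2)"
  proof (rule integrable_const_bound[where B = 1])
    show "AE z :: 'n \<Rightarrow> complex in torus. norm ((cmod (\<Prod>i\<in>UNIV. z i powi m i))\<^sup>2) \<le> 1"
      by (rule AE_I2) (simp add: space_torus prod_norm[symmetric] norm_power_int)
  qed measurable
  then show "square_integrable (\<lambda>z :: 'n \<Rightarrow> complex. \<Prod>i\<in>UNIV. z i powi m i) \<and>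
      square_integrable (\<lambda>z :: 'n \<Rightarrow> complex. \<Prod>i\<in>UNIV. z i powi m i) \<and>
      (AE z :: 'n \<Rightarrow> complex in torus. (\<Prod>i\<in>UNIV. z i powi m i) = (\<Prod>i\<in>UNIV. z i powi m i))"
    by (simp add: square_integrable_def)
qed

lift_definition mult_operator :: "'n::finite Linf \<Rightarrow> 'n L2 \<Rightarrow> 'n L2" is "\<lambda>\<phi> f z. \<phi> z * f z"
  by (auto intro!: square_integrable_mult)

text \<open>
  \<^const>\<open>bounded_linear\<close> only speaks about real scalars, hence the homogeneity condition.
\<close>

definition bounded_operator :: "('n::finite L2 \<Rightarrow> 'n L2) \<Rightarrow> bool" where
  "bounded_operator T \<longleftrightarrow> bounded_linear T \<and> (\<forall>c f. T (scaleC c f) = scaleC c (T f))"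

text \<open>
  The two definite descriptions below denote the intended operators: the adjoint of a bounded
  operator exists uniquely by the Riesz representation theorem, and a bounded operator is
  determined by its values on the orthonormal basis of monomials.
\<close>

definition adjoint_operator :: "('n::finite L2 \<Rightarrow> 'n L2) \<Rightarrow> 'n L2 \<Rightarrow> 'n L2" where
  "adjoint_operator T = (THE T'. bounded_operator T' \<and> (\<forall>f g. cinner (T f) g = cinner f (T' g)))"

definition hyponormal :: "('n::finite L2 \<Rightarrow> 'n L2) \<Rightarrow> bool" where
  "hyponormal T \<longleftrightarrow> bounded_operator T \<and> (\<forall>f. norm (T f) \<ge> norm (adjoint_operator T f))"

definition V_operator :: "nat \<Rightarrow> 'n::finite L2 \<Rightarrow> 'n L2" where
  "V_operator k = (THE T. bounded_operator T \<and>
     (\<forall>m. T (monomial m) =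
        (if \<forall>i. int k dvd m i then monomial (\<lambda>i. - (m i div int k)) else 0)))"

definition slant_Hankel :: "nat \<Rightarrow> 'n::finite Linf \<Rightarrow> 'n L2 \<Rightarrow> 'n L2" where
  "slant_Hankel k \<phi> = V_operator k \<circ> mult_operator \<phi>"

end

theory Submission
  imports Defs "HOL-Complex_Analysis.Cauchy_Integral_Theorem"
begin

text \<open>
  Write \<open>V\<close> for the operator \<open>\<V>\<^sub>k\<^sup>n\<close>. It is the adjoint of the isometry \<open>W g (z) = g (z\<^sup>-\<^sup>k)\<close>;
  concretely \<open>V f (z)\<close> is the average of \<open>f\<close> over the \<open>w\<close> with \<open>w\<^sup>-\<^sup>k = z\<close>, which gives its existence,
  and density of the trigonometric polynomials gives its uniqueness. Put \<open>u = \<phi> e\<^sub>m\<close>. The adjoint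
  of \<open>V M\<^sub>\<phi>\<close> maps \<open>e\<^sub>m\<close> to a function of norm \<open>\<parallel>\<phi>\<parallel>\<^sub>2 = \<parallel>u\<parallel>\<close>, so hyponormality at \<open>e\<^sub>m\<close> says
  \<open>\<parallel>u\<parallel> \<le> \<parallel>V u\<parallel>\<close>. Since \<open>V\<close> is a coisometry, \<open>u = W V u\<close>, and \<open>u\<close> is orthogonal to every \<open>e\<^sub>l\<close> with
  \<open>k\<close> not dividing \<open>l\<close>. With \<open>l = (1, \<dots>, 1)\<close> and \<open>m = l - j\<close> this is the vanishing of the \<open>j\<close>-th
  Fourier coefficient of \<open>\<phi>\<close>, for arbitrary \<open>j\<close>.
\<close>

section \<open>Characters and a functional monotone class theorem\<close>

definition character :: "('n::finite \<Rightarrow> int) \<Rightarrow> ('n \<Rightarrow> complex) \<Rightarrow> complex" where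
  "character m z = (\<Prod>i\<in>UNIV. z i powi m i)"

lemma norm_torus: "z \<in> space torus \<Longrightarrow> cmod (z i) = 1"
  by (simp add: space_torus)

lemma torus_nonzero: "z \<in> space torus \<Longrightarrow> z i \<noteq> 0"
  by (metis norm_torus norm_zero zero_neq_one)

lemma norm_character: "z \<in> space torus \<Longrightarrow> cmod (character m z) = 1"
  by (simp add: character_def norm_torus prod_norm[symmetric] norm_power_int)

lemma character_zero [simp]: "character (\<lambda>_. 0) z = 1"
  by (simp add: character_def)

lemma character_add:
  "z \<in> space torus \<Longrightarrow> character (\<lambda>i. m i + l i) z = character m z * character l z"
  by (simp add: character_def power_int_add torus_nonzero prod.distrib)

lemma cnj_character: "z \<in> space torus \<Longrightarrow> cnj (character m z) = character (\<lambda>i. - m i) z"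
proof -
  assume z: "z \<in> space torus"
  have "cnj (z i) = inverse (z i)" for i
    using norm_torus[OF z, of i] by (simp add: inverse_complex_def complex_eq_iff cmod_def)
  then show ?thesis
    by (simp add: character_def power_int_minus power_int_inverse)
qed

lemma character_measurable [measurable]: "character m \<in> borel_measurable torus"
  unfolding character_def power_int_def by measurable

section \<open>Borel sets and compactness of the torus\<close>

lemma id_measurable_torus: "(\<lambda>z. z) \<in> measurable (torus :: ('n::finite \<Rightarrow> complex) measure) borel"
proof -
  have "(\<lambda>z. z) \<in> measurable (torus :: ('n \<Rightarrow> complex) measure) (PiM UNIV (\<lambda>_. borel))"
    by (rule measurable_PiM_single') auto
  \<comment> \<open>The index set is finite and \<open>complex\<close> is second countable, so the
    product \<sigma>-algebra is the Borel one of the product topology.\<close>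
  then show ?thesis
    using sets_PiM_equal_borel measurable_cong_sets by blast
qed

lemma sets_circle: "sets circle = sets (restrict_space borel (sphere 0 1))"
  by (simp add: circle_def)

lemma space_circle: "space circle = sphere 0 1"
  by (simp add: circle_def space_restrict_space)

lemma measurable_into_torus:
  fixes f :: "'a \<Rightarrow> 'n::finite \<Rightarrow> complex"
  assumes "\<And>i. (\<lambda>x. f x i) \<in> borel_measurable M"
    and "\<And>x i. x \<in> space M \<Longrightarrow> cmod (f x i) = 1"
  shows "f \<in> measurable M torus"
proof -
  have "(\<lambda>x. f x i) \<in> measurable M circle" for i
    using assms
    by (subst measurable_cong_sets[OF refl sets_circle])
       (auto intro!: measurable_restrict_space2)
  then have "(\<lambda>x i. f x i) \<in> measurable M torus"
    unfolding torus_def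
    by (intro measurable_PiM_single') (auto dest: measurable_space)
  then show ?thesis by simp
qed

text \<open>The identity is measurable in both directions. Measurable subsets of the torus thereby
  become traces of Borel sets of the ambient function space, which the closed sets generate.\<close>

lemma sets_torus:
  "sets torus = sets (restrict_space borel (space (torus :: ('n::finite \<Rightarrow> complex) measure)))"
proof -
  let ?K = "space (torus :: ('n \<Rightarrow> complex) measure)"
  let ?R = "restrict_space borel ?K"
  have "(\<lambda>z. z) \<in> measurable ?R torus"
  proof (rule measurable_into_torus)
    show "(\<lambda>z. z i) \<in> borel_measurable ?R" for i :: 'n
      by (intro measurable_restrict_space1 borel_measurable_continuous_onI continuous_on_product_coordinates)
  qed (simp add: space_restrict_space norm_torus)
  then have "A \<in> sets ?R" if "A \<in> sets torus" for A
    using measurable_sets[OF _ that, of "\<lambda>z. z" ?R] sets.sets_into_space[OF that]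
    by (simp add: space_restrict_space Int_absorb2)
  moreover have "(\<lambda>z. z) \<in> measurable torus ?R"
    by (intro measurable_restrict_space2 id_measurable_torus) auto
  then have "A \<in> sets torus" if "A \<in> sets ?R" for A
    using measurable_sets[OF _ that, of "\<lambda>z. z" torus] sets.sets_into_space[OF that]
    by (simp add: space_restrict_space Int_absorb2)
  ultimately show ?thesis by blast
qed

lemma compact_torus: "compact (space (torus :: ('n::finite \<Rightarrow> complex) measure))"
proof -
  have "compactin (product_topology (\<lambda>_. euclidean) UNIV) (PiE (UNIV :: 'n set) (\<lambda>_. sphere (0 :: complex) 1))"
    by (simp add: compactin_PiE)
  moreover have "PiE (UNIV :: 'n set) (\<lambda>_. sphere (0 :: complex) 1) = space torus"
    by (auto simp: space_torus PiE_def)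
  ultimately show ?thesis
    by (simp add: euclidean_product_topology)
qed

text \<open>
  A functional monotone class theorem: Stone--Weierstrass reaches the continuous functions, limits
  reach indicators of closed sets, and Dynkin's theorem those of Borel sets.
\<close>

locale character_class =
  fixes C :: "(('n::finite \<Rightarrow> complex) \<Rightarrow> complex) set"
  assumes character: "character m \<in> C"
    and add: "f \<in> C \<Longrightarrow> g \<in> C \<Longrightarrow> (\<lambda>z. f z + g z) \<in> C"
    and cmult: "f \<in> C \<Longrightarrow> (\<lambda>z. c * f z) \<in> C"
    and limit: "f \<in> borel_measurable torus \<Longrightarrow> (\<And>n. F n \<in> C) \<Longrightarrow>
      (\<And>n z. z \<in> space torus \<Longrightarrow> cmod (F n z) \<le> B) \<Longrightarrow>
      (\<And>z. z \<in> space torus \<Longrightarrow> (\<lambda>n. F n z) \<longlonglongrightarrow> f z) \<Longrightarrow> f \<in> C"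
begin

inductive_set trig :: "(('n \<Rightarrow> complex) \<Rightarrow> complex) set" where
  monom: "(\<lambda>z. c * character m z) \<in> trig"
| sum: "f \<in> trig \<Longrightarrow> g \<in> trig \<Longrightarrow> (\<lambda>z. f z + g z) \<in> trig"

lemma zero: "(\<lambda>_. 0) \<in> C"
  using cmult[OF character, of 0] by simp

lemma trig_subset: "f \<in> trig \<Longrightarrow> f \<in> C"
  by (induction rule: trig.induct) (auto intro: add cmult character)

text \<open>Exponents of \<open>powi\<close> add only away from 0, so a product agrees with a
  trigonometric polynomial on the torus but possibly not elsewhere; hence the witness
  \<open>h\<close> in place of closure under products.\<close>

lemma trig_mult:
  assumes "f \<in> trig" "g \<in> trig"
  shows "\<exists>h\<in>trig. \<forall>z\<in>space torus. h z = f z * g z"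
  using assms(1)
proof induction
  case (monom c m)
  from assms(2) show ?case
  proof induction
    case (monom d l)
    show ?case
      by (rule bexI[of _ "\<lambda>z. (c * d) * character (\<lambda>i. m i + l i) z"])
         (auto simp: character_add intro: trig.monom)
  next
    case (sum g1 g2)
    then obtain h1 h2 where "h1 \<in> trig" "h2 \<in> trig"
      "\<forall>z\<in>space torus. h1 z = c * character m z * g1 z" "\<forall>z\<in>space torus. h2 z = c * character m z * g2 z"
      by blast
    then show ?case
      by (intro bexI[of _ "\<lambda>z. h1 z + h2 z"]) (auto simp: algebra_simps intro: trig.sum)
  qed
next
  case (sum f1 f2)
  then obtain h1 h2 where "h1 \<in> trig" "h2 \<in> trig"
    "\<forall>z\<in>space torus. h1 z = f1 z * g z" "\<forall>z\<in>space torus. h2 z = f2 z * g z"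
    by blast
  then show ?case
    by (intro bexI[of _ "\<lambda>z. h1 z + h2 z"]) (auto simp: algebra_simps intro: trig.sum)
qed

lemma cong:
  assumes "f \<in> C" "g \<in> borel_measurable torus" "\<And>z. z \<in> space torus \<Longrightarrow> g z = f z"
    "\<And>z. z \<in> space torus \<Longrightarrow> cmod (f z) \<le> B"
  shows "g \<in> C"
  by (rule limit[of g "\<lambda>_. f" B]) (use assms in auto)

text \<open>Stone--Weierstrass is applied in its real form, so the algebra consists of real
  functions that coincide on the torus with a complex trigonometric polynomial.\<close>

definition real_trig :: "(('n \<Rightarrow> complex) \<Rightarrow> real) set" where
  "real_trig = {f. continuous_on (space torus) f \<and>
     (\<exists>p\<in>trig. \<forall>z\<in>space torus. p z = of_real (f z))}"

lemma function_ring_real_trig: "function_ring_on real_trig (space torus)"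
proof
  show "compact (space (torus :: ('n \<Rightarrow> complex) measure))"
    by (rule compact_torus)
  show "continuous_on (space torus) f" if "f \<in> real_trig" for f
    using that by (simp add: real_trig_def)
  show "(\<lambda>x. f x + g x) \<in> real_trig" if "f \<in> real_trig" "g \<in> real_trig" for f g
  proof -
    from that obtain p q where "p \<in> trig" "q \<in> trig" "\<forall>z\<in>space torus. p z = of_real (f z)"
      "\<forall>z\<in>space torus. q z = of_real (g z)"
      by (auto simp: real_trig_def)
    then show ?thesis
      using that by (auto simp: real_trig_def intro!: continuous_intros bexI[of _ "\<lambda>z. p z + q z"] trig.sum)
  qed
  show "(\<lambda>x. f x * g x) \<in> real_trig" if "f \<in> real_trig" "g \<in> real_trig" for f g
  proof -
    from that obtain p q where pq: "p \<in> trig" "q \<in> trig" "\<forall>z\<in>space torus. p z = of_real (f z)"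
      "\<forall>z\<in>space torus. q z = of_real (g z)"
      by (auto simp: real_trig_def)
    then obtain h where "h \<in> trig" "\<forall>z\<in>space torus. h z = p z * q z"
      using trig_mult by blast
    then show ?thesis
      using that pq by (auto simp: real_trig_def intro!: continuous_intros bexI[of _ h])
  qed
  show "(\<lambda>_. c) \<in> real_trig" for c
    by (auto simp: real_trig_def intro!: bexI[OF _ trig.monom[of "of_real c" "\<lambda>_. 0"]])
  show "\<exists>f\<in>real_trig. f x \<noteq> f y" if xy: "x \<in> space torus" "y \<in> space torus" "x \<noteq> y" for x y
  proof -
    obtain i where i: "x i \<noteq> y i"
      using xy(3) by blast
    define e :: "'n \<Rightarrow> int" where "e = (\<lambda>j. if j = i then 1 else 0)"
    have e: "character e z = z i" for z
    proof -
      have "character e z = (\<Prod>j\<in>UNIV. if j = i then z j else 1)"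
        unfolding character_def e_def by (rule prod.cong) auto
      then show ?thesis by simp
    qed
    have e': "character (\<lambda>j. - e j) z = cnj (z i)" if "z \<in> space torus" for z
      using cnj_character[OF that, of e] by (simp add: e)
    have cont: "continuous_on A (\<lambda>z. z i)" for A :: "('n \<Rightarrow> complex) set"
      by (rule continuous_on_subset[OF continuous_on_product_coordinates]) auto
    \<comment> \<open>With w = \<open>z i\<close>, the characters of \<open>e\<close> and
      \<open>- e\<close> are w and its conjugate, so the real and imaginary parts are (w + cnj w) /
      2 and (w - cnj w) / (2 i).\<close>
    have "(\<lambda>z. (1/2) * character e z + (1/2) * character (\<lambda>j. - e j) z) \<in> trig"
      by (intro trig.intros)
    then have "(\<lambda>z. Re (z i)) \<in> real_trig"
      unfolding real_trig_def mem_Collect_eq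
      by (intro conjI continuous_on_Re cont) (rule bexI, auto simp: e e' complex_eq_iff)
    moreover
    have "(\<lambda>z. (-\<i>/2) * character e z + (\<i>/2) * character (\<lambda>j. - e j) z) \<in> trig"
      by (intro trig.intros)
    then have "(\<lambda>z. Im (z i)) \<in> real_trig"
      unfolding real_trig_def mem_Collect_eq
      by (intro conjI continuous_on_Im cont) (rule bexI, auto simp: e e' complex_eq_iff)
    moreover have "Re (x i) \<noteq> Re (y i) \<or> Im (x i) \<noteq> Im (y i)"
      using i by (auto simp: complex_eq_iff)
    ultimately show ?thesis by (elim disjE) (rule bexI; simp)+
  qed
qed

lemma continuous:
  assumes cont: "continuous_on UNIV (f :: _ \<Rightarrow> real)"
  shows "(\<lambda>z. of_real (f z)) \<in> C"
proof -
  interpret R: function_ring_on real_trig "space torus"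
    by (rule function_ring_real_trig)
  have cont': "continuous_on (space torus) f"
    using cont continuous_on_subset by blast
  obtain F where F: "\<And>n. F n \<in> real_trig" "uniform_limit (space torus) F f sequentially"
    using R.Stone_Weierstrass[OF cont'] by blast
  have "\<exists>p\<in>trig. \<forall>z\<in>space torus. p z = of_real (F n z)" for n
    using F(1)[of n] by (simp add: real_trig_def)
  then obtain p where p: "\<And>n. p n \<in> trig" "\<And>n z. z \<in> space torus \<Longrightarrow> p n z = of_real (F n z)"
    by metis
  \<comment> \<open>The \<open>limit\<close> axiom asks for one bound on the whole sequence. From
    \<open>N\<close> on the approximants are within 1 of \<open>f\<close>, so the shifted sequence
    is bounded by \<open>B + 1\<close>.\<close>
  have "eventually (\<lambda>n. \<forall>z\<in>space torus. dist (F n z) (f z) < 1) sequentially"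
    using F(2) by (simp add: uniform_limit_iff)
  then obtain N where N: "\<And>n z. n \<ge> N \<Longrightarrow> z \<in> space torus \<Longrightarrow> dist (F n z) (f z) < 1"
    by (auto simp: eventually_sequentially)
  have "bounded (f ` space torus)"
    by (intro compact_imp_bounded compact_continuous_image cont' compact_torus)
  then obtain B where B: "\<And>z. z \<in> space torus \<Longrightarrow> \<bar>f z\<bar> \<le> B"
    by (auto simp: bounded_iff)
  show ?thesis
  proof (rule limit[where F = "\<lambda>n. p (n + N)" and B = "B + 1"])
    have "f \<in> borel_measurable torus"
      by (rule measurable_compose[OF id_measurable_torus borel_measurable_continuous_onI[OF cont]])
    then show "(\<lambda>z. complex_of_real (f z)) \<in> borel_measurable torus"
      by measurable
    show "p (n + N) \<in> C" for n
      by (rule trig_subset[OF p(1)])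
    show "cmod (p (n + N) z) \<le> B + 1" if "z \<in> space torus" for n z
      using N[of "n + N", OF _ that] B[OF that] by (simp add: p(2)[OF that] dist_real_def)
    show "(\<lambda>n. p (n + N) z) \<longlonglongrightarrow> complex_of_real (f z)" if "z \<in> space torus" for z
    proof -
      have "(\<lambda>n. F n z) \<longlonglongrightarrow> f z"
        using tendsto_uniform_limitI[OF F(2) that] .
      then have "(\<lambda>n. F (n + N) z) \<longlonglongrightarrow> f z"
        by (rule LIMSEQ_ignore_initial_segment)
      then show ?thesis
        by (simp add: p(2)[OF that] tendsto_of_real)
    qed
  qed
qed

lemma indicator_measurable: "A \<in> sets borel \<Longrightarrow> indicator A \<in> borel_measurable torus"
  by (rule measurable_compose[OF id_measurable_torus borel_measurable_indicator])

lemma indicator_closed: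
  assumes "closed A"
  shows "(indicator A :: _ \<Rightarrow> complex) \<in> C"
\<comment> \<open>\<open>infdist z {}\<close> is 0 by convention, so for empty \<open>A\<close> the
  functions below would be constantly 1.\<close>
proof (cases "A = {}")
  case True
  then have "indicator A = (\<lambda>_. 0 :: complex)"
    by (intro ext) simp
  then show ?thesis
    using zero by simp
next
  case False
  \<comment> \<open>Continuous functions equal to 1 on \<open>A\<close>; at each point off the
    closed set \<open>A\<close> the distance is positive, so they are eventually 0.\<close>
  let ?F = "\<lambda>(n::nat) z. max 0 (1 - real n * infdist z A)"
  show ?thesis
  proof (rule limit[where F = "\<lambda>n z. of_real (?F n z)" and B = 1])
    show "indicator A \<in> borel_measurable torus"
      by (rule indicator_measurable) (use assms in simp)
    show "(\<lambda>z. complex_of_real (?F n z)) \<in> C" for n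
      by (intro continuous continuous_intros)
    show "cmod (complex_of_real (?F n z)) \<le> 1" for n z
      by (auto simp: infdist_nonneg)
    show "(\<lambda>n. complex_of_real (?F n z)) \<longlonglongrightarrow> indicator A z" for z
    proof (cases "z \<in> A")
      case True
      then show ?thesis by simp
    next
      case z: False
      then have pos: "infdist z A > 0"
        using assms False by (metis in_closed_iff_infdist_zero infdist_nonneg less_eq_real_def)
      obtain N where N: "real N * infdist z A \<ge> 1"
        using reals_Archimedean3[OF pos, rule_format, of 1] by (metis less_imp_le)
      have "eventually (\<lambda>n. complex_of_real (?F n z) = 0) sequentially"
      proof (rule eventually_sequentiallyI)
        fix n assume "N \<le> n"
        then have "real N * infdist z A \<le> real n * infdist z A"
          by (intro mult_right_mono) (auto simp: infdist_nonneg)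
        then show "complex_of_real (?F n z) = 0"
          using N by simp
      qed
      then show ?thesis
        using z by (simp add: tendsto_eventually)
    qed
  qed
qed

lemma sum_class: "finite I \<Longrightarrow> (\<And>i. i \<in> I \<Longrightarrow> f i \<in> C) \<Longrightarrow> (\<lambda>z. \<Sum>i\<in>I. f i z) \<in> C"
proof (induction I rule: finite_induct)
  case empty
  show ?case
    using zero by simp
qed (auto intro: add)

lemma indicator_borel:
  assumes "A \<in> sets borel"
  shows "(indicator A :: _ \<Rightarrow> complex) \<in> C"
proof -
  have "Int_stable (Collect closed :: ('n \<Rightarrow> complex) set set)"
    by (auto simp: Int_stable_def)
  moreover have "Collect closed \<subseteq> Pow (UNIV :: ('n \<Rightarrow> complex) set)"
    by auto
  moreover have "A \<in> sigma_sets UNIV (Collect closed)"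
    using assms by (simp add: borel_eq_closed)
  ultimately show ?thesis
  proof (induction rule: sigma_sets_induct_disjoint)
    case (compl A)
    have "(\<lambda>z. character (\<lambda>_. 0) z + (-1) * indicator A z) \<in> C"
      by (intro add cmult character compl)
    moreover have "indicator (UNIV - A) = (\<lambda>z. character (\<lambda>_. 0) z + (-1) * indicator A z :: complex)"
      by (auto simp: indicator_def)
    ultimately show ?case
      by simp
  next
    case (union A)
    have borel: "A i \<in> sets borel" for i
      using union(2) by (auto simp: borel_eq_closed)
    show ?case
    proof (rule limit[where F = "\<lambda>n z. \<Sum>i<n. indicator (A i) z" and B = 1])
      show "indicator (\<Union> (range A)) \<in> borel_measurable torus"
        using borel by (intro indicator_measurable) auto
      show "(\<lambda>z. \<Sum>i<n. indicator (A i) z) \<in> C" for n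
        by (intro sum_class union) auto
      \<comment> \<open>Disjointness makes each partial sum an indicator, which gives both the bound
        1 and the pointwise limit.\<close>
      have sum_eq: "(\<Sum>i<n. indicator (A i) z) = (indicator (\<Union>i<n. A i) z :: complex)" for n z
        using union(1) by (intro indicator_UN_disjoint[symmetric]) (auto simp: disjoint_family_on_def)
      then show "cmod (\<Sum>i<n. indicator (A i) z) \<le> 1" for n z
        by (simp add: indicator_def)
      show "(\<lambda>n. \<Sum>i<n. indicator (A i) z) \<longlonglongrightarrow> (indicator (\<Union> (range A)) z :: complex)" for z
        unfolding sum_eq by (rule LIMSEQ_indicator_UN)
    qed
  qed (auto intro: indicator_closed zero)
qed

text \<open>Simple functions of modulus at most \<open>2 * cmod (f z)\<close> converge pointwise to
  \<open>f\<close>, and on the torus each is a finite combination of indicators of Borel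
  sets.\<close>

theorem bounded_measurable:
  assumes f: "f \<in> borel_measurable torus" and bound: "\<And>z. z \<in> space torus \<Longrightarrow> cmod (f z) \<le> B"
  shows "f \<in> C"
proof -
  obtain F where F: "\<And>i. simple_function torus (F i)" "\<And>z. z \<in> space torus \<Longrightarrow> (\<lambda>i. F i z) \<longlonglongrightarrow> f z"
    "\<And>i z. z \<in> space torus \<Longrightarrow> dist (F i z) 0 \<le> 2 * dist (f z) 0"
    using borel_measurable_implies_sequence_metric[OF f, of 0] by blast
  have "\<exists>g\<in>C. \<forall>z\<in>space torus. g z = F n z" for n
  proof -
    \<comment> \<open>\<open>indicator_borel\<close> concerns Borel sets of the ambient space, so
      every level set is written as the trace of such a set on the torus.\<close>
    have "\<exists>A\<in>sets borel. F n -` {y} \<inter> space torus = space torus \<inter> A" for y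
      using simple_functionD(2)[OF F(1)[of n], of "{y}"]
      unfolding sets_torus sets_restrict_space by blast
    then obtain A where A: "\<And>y. A y \<in> sets borel" "\<And>y. F n -` {y} \<inter> space torus = space torus \<inter> A y"
      by metis
    have "(\<lambda>z. \<Sum>y\<in>F n ` space torus. y * indicator (A y) z) \<in> C"
      using F(1)[of n] by (intro sum_class cmult indicator_borel A) (simp add: simple_function_def)
    moreover have "(\<Sum>y\<in>F n ` space torus. y * indicator (A y) z) = F n z" if z: "z \<in> space torus" for z
    proof -
      have iff: "z \<in> A y \<longleftrightarrow> y = F n z" for y
      proof -
        have "z \<in> F n -` {y} \<inter> space torus \<longleftrightarrow> z \<in> space torus \<inter> A y"
          by (simp only: A(2))
        then show ?thesis
          using z by auto
      qed
      have "(\<Sum>y\<in>F n ` space torus. y * indicator (A y) z)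
          = (\<Sum>y\<in>F n ` space torus. if y = F n z then y else 0)"
        by (rule sum.cong) (auto simp: indicator_def iff)
      then show ?thesis
        using F(1)[of n] z by (simp add: simple_function_def)
    qed
    ultimately show ?thesis by (intro bexI ballI)
  qed
  then obtain G where G: "\<And>n. G n \<in> C" "\<And>n z. z \<in> space torus \<Longrightarrow> G n z = F n z"
    by metis
  show ?thesis
  proof (rule limit[OF f G(1), where B = "2 * B"])
    show "cmod (G n z) \<le> 2 * B" if "z \<in> space torus" for n z
      using F(3)[OF that, of n] bound[OF that] by (simp add: G(2)[OF that])
    show "(\<lambda>n. G n z) \<longlonglongrightarrow> f z" if "z \<in> space torus" for z
      using F(2)[OF that] by (simp add: G(2)[OF that])
  qed
qed

end

section \<open>Measure-preserving maps of the torus\<close>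

lemma circle_integral_power_int:
  "integrable circle (\<lambda>z. z powi m)" (is ?int)
  "(\<integral>z. z powi m \<partial>circle) = (if m = 0 then 1 else 0)" (is ?eq)
proof -
  interpret prob_space circle
    by (rule prob_space_circle)
  have meas [measurable]: "(\<lambda>z. z powi m) \<in> borel_measurable circle"
    unfolding circle_def power_int_def by (simp add: measurable_restrict_space1)
  show ?int
    by (rule integrable_const_bound[where B = 1]) (auto simp: space_circle norm_power_int)
  have cis_power: "cis t powi m = cis (of_int m * t)" for t
    by (simp add: cis_power_int)
  show ?eq
  proof (cases "m = 0")
    case True
    then show ?thesis
      by (simp add: prob_space)
  next
    case False
    let ?I = "{0..<2 * pi}"
    have dens: "uniform_measure lborel ?I = density lborel (\<lambda>x. ennreal (indicator ?I x / (2 * pi)))"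
      unfolding uniform_measure_def
      by (intro arg_cong2[where f = density] ext)
         (auto simp: divide_ennreal indicator_def ennreal_1[symmetric] simp del: ennreal_1)
    have cis_meas: "cis \<in> measurable (uniform_measure lborel ?I) (restrict_space borel (sphere 0 1))"
      by (intro measurable_restrict_space2)
         (auto simp: measurable_cong_sets[OF sets_uniform_measure refl]
           intro!: borel_measurable_continuous_onI continuous_intros)
    have cont: "continuous_on A (\<lambda>t. cis (of_int m * t))" for A
      by (intro continuous_intros)
    have [measurable]: "(\<lambda>t. cis (of_int m * t)) \<in> borel_measurable borel"
      by (rule borel_measurable_continuous_onI[OF cont])
    have "(\<integral>z. z powi m \<partial>circle) = (\<integral>t. cis t powi m \<partial>uniform_measure lborel ?I)"
      using meas unfolding circle_def
      by (intro integral_distr cis_meas) (simp add: measurable_distr_eq1)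
    also have "\<dots> = (\<integral>t. (indicator ?I t / (2 * pi)) *\<^sub>R cis (of_int m * t) \<partial>lborel)"
      unfolding dens cis_power
      by (intro integral_density)
         (auto intro!: borel_measurable_continuous_onI cont)
    \<comment> \<open>Adding the endpoint \<open>2 * pi\<close>, a null set, gives the closed
      interval that the fundamental theorem of calculus asks for.\<close>
    also have "\<dots> = (\<integral>t. indicator {0..2 * pi} t *\<^sub>R ((1 / (2 * pi)) *\<^sub>R cis (of_int m * t)) \<partial>lborel)"
    proof (rule integral_cong_AE)
      show "AE t in lborel. (indicator ?I t / (2 * pi)) *\<^sub>R cis (of_int m * t) =
          indicator {0..2 * pi} t *\<^sub>R ((1 / (2 * pi)) *\<^sub>R cis (of_int m * t))"
        using AE_lborel_singleton[of "2 * pi"] by eventually_elim (auto simp: indicator_def)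
    qed measurable
    also have "\<dots> = (1 / (2 * pi * \<i> * of_int m)) * cis (of_int m * (2 * pi))
        - (1 / (2 * pi * \<i> * of_int m)) * cis (of_int m * 0)"
    proof (rule integral_FTC_atLeastAtMost)
      fix x :: real
      have "((\<lambda>t. cis (of_int m * t)) has_vector_derivative (of_int m *\<^sub>R (\<i> * cis (of_int m * x)))) (at x within {0..2*pi})"
        by (rule has_vector_derivative_at_within)
           (auto intro!: derivative_eq_intros simp: has_vector_derivative_def scaleR_conv_of_real)
      then have "((\<lambda>t. (1 / (2 * pi * \<i> * of_int m)) * cis (of_int m * t)) has_vector_derivative
          (1 / (2 * pi * \<i> * of_int m)) * (of_int m *\<^sub>R (\<i> * cis (of_int m * x)))) (at x within {0..2*pi})"
        by (rule has_vector_derivative_mult_right)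
      moreover have "(1 / (2 * pi * \<i> * of_int m)) * (of_int m *\<^sub>R (\<i> * cis (of_int m * x)))
          = (1 / (2 * pi)) *\<^sub>R cis (of_int m * x)"
        using False by (simp add: scaleR_conv_of_real field_simps)
      ultimately show "((\<lambda>t. (1 / (2 * pi * \<i> * of_int m)) * cis (of_int m * t)) has_vector_derivative
          (1 / (2 * pi)) *\<^sub>R cis (of_int m * x)) (at x within {0..2*pi})"
        by simp
    qed (auto intro!: continuous_intros)
    also have "cis (of_int m * (2 * pi)) = 1"
      using cis_multiple_2pi[of "of_int m"] by (simp add: mult.commute)
    finally show ?thesis
      using False by simp
  qed
qed

lemma integral_character: "(\<integral>z. character m z \<partial>torus) = (if m = (\<lambda>_. 0) then 1 else 0)"
proof -
  interpret prob_space circle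
    by (rule prob_space_circle)
  interpret product_sigma_finite "\<lambda>_. circle"
    by standard
  have "(\<integral>z. character m z \<partial>torus) = (\<Prod>i\<in>UNIV. \<integral>x. x powi m i \<partial>circle)"
    unfolding torus_def character_def
    by (rule product_integral_prod) (auto intro: circle_integral_power_int)
  also have "\<dots> = (if m = (\<lambda>_. 0) then 1 else 0)"
    by (auto simp: circle_integral_power_int fun_eq_iff)
  finally show ?thesis .
qed

definition torus_preserving :: "(('n::finite \<Rightarrow> complex) \<Rightarrow> 'n \<Rightarrow> complex) \<Rightarrow> bool" where
  "torus_preserving \<tau> \<longleftrightarrow> \<tau> \<in> measurable torus torus \<and> distr torus torus \<tau> = torus"

text \<open>Fourier coefficients determine a probability measure on the torus: the functions whose
  integral is unchanged by \<tau> form a \<open>character_class\<close>, which therefore contains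
  all indicators.\<close>

lemma torus_preservingI:
  fixes \<tau> :: "('n::finite \<Rightarrow> complex) \<Rightarrow> 'n \<Rightarrow> complex"
  assumes \<tau> [measurable]: "\<tau> \<in> measurable torus torus"
    and eq: "\<And>m. (\<integral>z. character m (\<tau> z) \<partial>torus) = (\<integral>z. character m z \<partial>torus)"
  shows "torus_preserving \<tau>"
proof -
  interpret prob_space "torus :: ('n \<Rightarrow> complex) measure"
    by (rule prob_space_torus)
  \<comment> \<open>Integrability is part of the class because additivity of the integral relies on
    it.\<close>
  define C where "C = {f :: ('n \<Rightarrow> complex) \<Rightarrow> complex. integrable torus f \<and>
    integrable torus (\<lambda>z. f (\<tau> z)) \<and> (\<integral>z. f (\<tau> z) \<partial>torus) = (\<integral>z. f z \<partial>torus)}"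
  have \<tau>_space: "z \<in> space torus \<Longrightarrow> \<tau> z \<in> space torus" for z
    using \<tau> by (rule measurable_space)
  interpret character_class C
  proof
    show "character m \<in> C" for m
      by (auto simp: C_def eq norm_character \<tau>_space intro!: integrable_const_bound[where B = 1])
    show "f \<in> C" if f [measurable]: "f \<in> borel_measurable torus" and F: "\<And>n. F n \<in> C"
      and B: "\<And>n z. z \<in> space torus \<Longrightarrow> cmod (F n z) \<le> B"
      and lim: "\<And>z. z \<in> space torus \<Longrightarrow> (\<lambda>n. F n z) \<longlonglongrightarrow> f z" for f F B
    proof -
      have Fm [measurable]: "F n \<in> borel_measurable torus" for n
        using F[of n] by (simp add: C_def borel_measurable_integrable)
      have *: "integrable torus f" "(\<lambda>n. \<integral>z. F n z \<partial>torus) \<longlonglongrightarrow> (\<integral>z. f z \<partial>torus)"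
        by (rule integrable_dominated_convergence[where w = "\<lambda>_. B" and s = F]
            integral_dominated_convergence[where w = "\<lambda>_. B"]; auto intro: lim B)+
      have **: "integrable torus (\<lambda>z. f (\<tau> z))"
          "(\<lambda>n. \<integral>z. F n (\<tau> z) \<partial>torus) \<longlonglongrightarrow> (\<integral>z. f (\<tau> z) \<partial>torus)"
        by (rule integrable_dominated_convergence[where w = "\<lambda>_. B" and s = "\<lambda>n z. F n (\<tau> z)"]
            integral_dominated_convergence[where w = "\<lambda>_. B"]; auto intro: lim B \<tau>_space)+
      have "(\<integral>z. F n (\<tau> z) \<partial>torus) = (\<integral>z. F n z \<partial>torus)" for n
        using F[of n] by (simp add: C_def)
      then show ?thesis
        using * ** LIMSEQ_unique by (simp add: C_def)
    qed
  qed (auto simp: C_def)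
  have "distr torus torus \<tau> = torus"
  proof (rule measure_eqI)
    fix A assume "A \<in> sets (distr torus torus \<tau>)"
    then have A [measurable]: "A \<in> sets torus"
      by simp
    have "(indicator A :: _ \<Rightarrow> complex) \<in> C"
      by (rule bounded_measurable[where B = 1]) (auto simp: indicator_def)
    then have "(\<integral>z. complex_of_real (indicator A (\<tau> z)) \<partial>torus) = (\<integral>z. complex_of_real (indicator A z) \<partial>torus)"
      by (simp add: C_def of_real_indicator)
    then have "(\<integral>z. indicator A (\<tau> z) \<partial>torus) = (\<integral>z. indicator A z \<partial>torus :: real)"
      by (simp only: integral_complex_of_real of_real_eq_iff)
    moreover have "(\<integral>z. indicator A (\<tau> z) \<partial>torus) = (\<integral>z. indicator A z \<partial>distr torus torus \<tau> :: real)"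
      by (intro integral_distr[symmetric]) auto
    ultimately have "measure (distr torus torus \<tau>) A = measure torus A"
      by simp
    moreover have "finite_measure (distr torus torus \<tau>)"
      using prob_space_distr[OF \<tau>] by (simp add: prob_space_def)
    ultimately show "emeasure (distr torus torus \<tau>) A = emeasure torus A"
      by (simp add: finite_measure.emeasure_eq_measure emeasure_eq_measure)
  qed simp
  then show ?thesis
    by (simp add: torus_preserving_def)
qed

section \<open>The Hilbert space and density of the monomials\<close>

lemma square_integrable_rep_L2: "square_integrable (rep_L2 F)"
  using Quotient_rep_reflp[OF Quotient_L2] by blast

lemma abs_rep_L2: "abs_L2 (rep_L2 F) = F"
  by (rule Quotient_abs_rep[OF Quotient_L2])

lemma abs_L2_cases:
  obtains f where "square_integrable f" "F = abs_L2 f"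
  using square_integrable_rep_L2 abs_rep_L2 by metis

lemma abs_L2_eq_iff:
  assumes "square_integrable f" "square_integrable g"
  shows "abs_L2 f = abs_L2 g \<longleftrightarrow> (AE z in torus. f z = g z)"
  using Quotient_rel[OF Quotient_L2, of f g] assms by auto

lemma rep_abs_L2:
  assumes "square_integrable f"
  shows "AE z in torus. rep_L2 (abs_L2 f) z = f z"
  by (rule abs_L2_eq_iff[OF square_integrable_rep_L2 assms, THEN iffD1, OF abs_rep_L2])

lemma abs_L2_add:
  "square_integrable f \<Longrightarrow> square_integrable g \<Longrightarrow> abs_L2 f + abs_L2 g = abs_L2 (\<lambda>z. f z + g z)"
  by (intro plus_L2.abs_eq) auto

lemma abs_L2_scaleC:
  "square_integrable f \<Longrightarrow> scaleC c (abs_L2 f) = abs_L2 (\<lambda>z. c * f z)"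
  by (intro scaleC.abs_eq) auto

lemma cinner_abs_L2:
  "square_integrable f \<Longrightarrow> square_integrable g \<Longrightarrow>
    cinner (abs_L2 f) (abs_L2 g) = (\<integral>z. f z * cnj (g z) \<partial>torus)"
  by (intro cinner.abs_eq) auto

lemma square_integrable_character: "square_integrable (character m)"
  unfolding character_def[abs_def]
  using monomial.rsp[THEN rel_funD, OF refl] by simp

lemma monomial_eq: "monomial m = abs_L2 (character m)"
  by (simp add: monomial.abs_eq character_def[abs_def])

lemma cinner_commute: "cinner G F = cnj (cinner F G)"
proof (cases F rule: abs_L2_cases, cases G rule: abs_L2_cases)
  fix f g assume "square_integrable f" "F = abs_L2 f" "square_integrable g" "G = abs_L2 g"
  then show ?thesis
    by (simp add: cinner_abs_L2 mult.commute flip: Bochner_Integration.integral_cnj)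
qed

lemma cinner_add_left: "cinner (F + G) H = cinner F H + cinner G H"
  by transfer (simp add: distrib_right integrable_mult_cnj)

lemma cinner_scaleC_left: "cinner (scaleC c F) G = c * cinner F G"
  by transfer (simp add: mult.assoc)

lemma cinner_diff_left: "cinner (F - G) H = cinner F H - cinner G H"
  by (simp add: minus_L2_def uminus_L2_def cinner_add_left cinner_scaleC_left)

lemma cinner_scaleC_right: "cinner G (scaleC c F) = cnj c * cinner G F"
  by (simp add: cinner_commute[of G] cinner_scaleC_left)

lemma cinner_zero_left [simp]: "cinner 0 F = 0"
  using cinner_diff_left[of 0 0 F] by simp

lemma cinner_zero_right [simp]: "cinner F 0 = 0"
  using cinner_commute[of F 0] by simp

text \<open>Definiteness of the inner product, tested at \<open>H = F - G\<close>. Operators known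
  through an adjoint relation get their linearity from this criterion.\<close>

lemma cinner_eqI:
  assumes "\<And>H. cinner F H = cinner G H"
  shows "F = G"
proof -
  have "cinner (F - G) (F - G) = 0"
    by (simp add: cinner_diff_left[of F G] assms)
  then have "inner (F - G) (F - G) = 0"
    by (simp add: inner_L2_def)
  then show ?thesis by simp
qed

lemma norm_scaleC: "norm (scaleC c F) = cmod c * norm F"
proof -
  have "cinner (scaleC c F) (scaleC c F) = of_real ((cmod c)\<^sup>2) * cinner F F"
    by (simp only: complex_norm_square mult_ac cinner_scaleC_left cinner_scaleC_right)
  then show ?thesis
    by (simp add: norm_L2_def real_sqrt_mult flip: of_real_power)
qed

lemma scaleR_eq_scaleC: "r *\<^sub>R F = scaleC (of_real r) F" for F :: "'n::finite L2"
  by (rule scaleR_L2_def)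

lemma bounded_operatorI:
  assumes "\<And>F G. T (F + G) = T F + T G" "\<And>c F. T (scaleC c F) = scaleC c (T F)"
    and "\<And>F. norm (T F) \<le> B * norm F"
  shows "bounded_operator T"
proof -
  have "bounded_linear T"
  proof (rule bounded_linear_intro)
    show "norm (T x) \<le> norm x * B" for x
      using assms(3)[of x] by (simp add: mult.commute)
  qed (simp_all add: assms(1,2) scaleR_eq_scaleC)
  then show ?thesis
    by (simp add: bounded_operator_def assms(2))
qed

lemma norm_abs_L2:
  assumes "square_integrable f"
  shows "(norm (abs_L2 f))\<^sup>2 = (\<integral>z. (cmod (f z))\<^sup>2 \<partial>torus)"
proof -
  have "cinner (abs_L2 f) (abs_L2 f) = (\<integral>z. of_real ((cmod (f z))\<^sup>2) \<partial>torus)"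
    using assms by (simp add: cinner_abs_L2 flip: complex_norm_square)
  also have "\<dots> = of_real (\<integral>z. (cmod (f z))\<^sup>2 \<partial>torus)"
    by (rule integral_complex_of_real)
  finally show ?thesis
    by (simp add: norm_L2_def integral_nonneg_AE)
qed

section \<open>Convergence in L^2 and density of trigonometric polynomials\<close>

lemma abs_L2_diff:
  "square_integrable f \<Longrightarrow> square_integrable g \<Longrightarrow> abs_L2 f - abs_L2 g = abs_L2 (\<lambda>z. f z - g z)"
  using abs_L2_add[of f "\<lambda>z. (-1) * g z"] abs_L2_scaleC[of g "-1"] square_integrable_cmult[of g "-1"]
  by (simp add: minus_L2_def uminus_L2_def)

lemma square_integrable_diff:
  "square_integrable f \<Longrightarrow> square_integrable g \<Longrightarrow> square_integrable (\<lambda>z. f z - g z)"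
  using square_integrable_add[of f "\<lambda>z. (-1) * g z"] square_integrable_cmult[of g "-1"] by simp

lemma square_integrable_dominated:
  assumes "f \<in> borel_measurable torus" "square_integrable w" "\<And>z. z \<in> space torus \<Longrightarrow> cmod (f z) \<le> cmod (w z)"
  shows "square_integrable f"
proof -
  note [measurable] = assms(1)
  have "integrable torus (\<lambda>z. (cmod (f z))\<^sup>2)"
  proof (rule Bochner_Integration.integrable_bound)
    show "integrable torus (\<lambda>z. (cmod (w z))\<^sup>2)"
      using assms(2) by (simp add: square_integrable_def)
    show "AE z in torus. norm ((cmod (f z))\<^sup>2) \<le> norm ((cmod (w z))\<^sup>2)"
      using assms(3) by (intro AE_I2) (simp add: power_mono)
  qed measurable
  then show ?thesis
    using assms(1) by (simp add: square_integrable_def)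
qed

text \<open>Dominated convergence for \<open>(cmod (F n z - f z))\<^sup>2\<close>: both
  \<open>F n\<close> and its limit are bounded by \<open>w\<close>, whence the majorant
  \<open>4 * (cmod (w z))\<^sup>2\<close>.\<close>

lemma abs_L2_tendsto:
  assumes f: "f \<in> borel_measurable torus" and F: "\<And>n. F n \<in> borel_measurable torus"
    and w: "square_integrable w" and bound: "\<And>n z. z \<in> space torus \<Longrightarrow> cmod (F n z) \<le> cmod (w z)"
    and lim: "\<And>z. z \<in> space torus \<Longrightarrow> (\<lambda>n. F n z) \<longlonglongrightarrow> f z"
  shows "square_integrable f" "(\<lambda>n. abs_L2 (F n)) \<longlonglongrightarrow> abs_L2 f"
proof -
  have f_bound: "cmod (f z) \<le> cmod (w z)" if "z \<in> space torus" for z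
    by (rule LIMSEQ_le_const2[OF tendsto_norm[OF lim[OF that]]]) (use bound[OF that] in auto)
  show sf: "square_integrable f"
    by (rule square_integrable_dominated[OF f w f_bound])
  have sF: "square_integrable (F n)" for n
    by (rule square_integrable_dominated[OF F w bound])
  note [measurable] = f F
  have "(\<lambda>n. \<integral>z. (cmod (F n z - f z))\<^sup>2 \<partial>torus) \<longlonglongrightarrow> (\<integral>z. 0 \<partial>(torus :: ('a \<Rightarrow> complex) measure))"
  proof (rule integral_dominated_convergence[where w = "\<lambda>z. 4 * (cmod (w z))\<^sup>2"])
    show "integrable torus (\<lambda>z. 4 * (cmod (w z))\<^sup>2)"
      using w by (simp add: square_integrable_def)
    show "AE z in torus. (\<lambda>n. (cmod (F n z - f z))\<^sup>2) \<longlonglongrightarrow> 0"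
    proof (rule AE_I2)
      fix z :: "'a \<Rightarrow> complex" assume "z \<in> space torus"
      then have "(\<lambda>n. (cmod (F n z - f z))\<^sup>2) \<longlonglongrightarrow> (cmod (f z - f z))\<^sup>2"
        by (intro tendsto_intros lim)
      then show "(\<lambda>n. (cmod (F n z - f z))\<^sup>2) \<longlonglongrightarrow> 0"
        by simp
    qed
    show "AE z in torus. norm ((cmod (F n z - f z))\<^sup>2) \<le> 4 * (cmod (w z))\<^sup>2" for n
    proof (rule AE_I2)
      fix z :: "'a \<Rightarrow> complex" assume z: "z \<in> space torus"
      have "cmod (F n z - f z) \<le> 2 * cmod (w z)"
        using norm_triangle_ineq4[of "F n z" "f z"] bound[OF z, of n] f_bound[OF z] by linarith
      then have "(cmod (F n z - f z))\<^sup>2 \<le> (2 * cmod (w z))\<^sup>2"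
        by (intro power_mono) auto
      then show "norm ((cmod (F n z - f z))\<^sup>2) \<le> 4 * (cmod (w z))\<^sup>2"
        by (simp add: power_mult_distrib)
    qed
  qed measurable
  then have "(\<lambda>n. (norm (abs_L2 (F n) - abs_L2 f))\<^sup>2) \<longlonglongrightarrow> 0"
    by (simp add: abs_L2_diff sF sf norm_abs_L2 square_integrable_diff)
  then have "(\<lambda>n. sqrt ((norm (abs_L2 (F n) - abs_L2 f))\<^sup>2)) \<longlonglongrightarrow> sqrt 0"
    by (rule tendsto_real_sqrt)
  then show "(\<lambda>n. abs_L2 (F n)) \<longlonglongrightarrow> abs_L2 f"
    by (simp add: LIM_zero_iff tendsto_norm_zero_iff)
qed

text \<open>Density, phrased as an induction principle over closed complex subspaces. The functions
  whose class lies in \<open>S\<close> form a \<open>character_class\<close>, which yields the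
  bounded functions; truncation yields the rest.\<close>

theorem monomials_dense:
  fixes S :: "'n::finite L2 set"
  assumes S: "closed S" "\<And>m. monomial m \<in> S" "\<And>F G. F \<in> S \<Longrightarrow> G \<in> S \<Longrightarrow> F + G \<in> S"
    "\<And>c F. F \<in> S \<Longrightarrow> scaleC c F \<in> S"
  shows "F \<in> S"
proof -
  interpret prob_space "torus :: ('n \<Rightarrow> complex) measure"
    by (rule prob_space_torus)
  have const: "square_integrable (\<lambda>_ :: 'n \<Rightarrow> complex. c)" for c
    by (simp add: square_integrable_def)
  interpret character_class "{f. square_integrable f \<and> abs_L2 f \<in> S}"
  proof
    show "character m \<in> {f. square_integrable f \<and> abs_L2 f \<in> S}" for m
      using S(2)[of m] by (simp add: square_integrable_character monomial_eq)
    show "(\<lambda>z. f z + g z) \<in> {f. square_integrable f \<and> abs_L2 f \<in> S}"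
      if "f \<in> {f. square_integrable f \<and> abs_L2 f \<in> S}" "g \<in> {f. square_integrable f \<and> abs_L2 f \<in> S}" for f g
      using that S(3) by (auto intro: square_integrable_add simp flip: abs_L2_add)
    show "(\<lambda>z. c * f z) \<in> {f. square_integrable f \<and> abs_L2 f \<in> S}"
      if "f \<in> {f. square_integrable f \<and> abs_L2 f \<in> S}" for c f
      using that S(4) by (auto intro: square_integrable_cmult simp flip: abs_L2_scaleC)
    show "f \<in> {f. square_integrable f \<and> abs_L2 f \<in> S}"
      if f: "f \<in> borel_measurable torus" and F: "\<And>n. F n \<in> {f. square_integrable f \<and> abs_L2 f \<in> S}"
      and B: "\<And>n z. z \<in> space torus \<Longrightarrow> cmod (F n z) \<le> B"
      and lim: "\<And>z. z \<in> space torus \<Longrightarrow> (\<lambda>n. F n z) \<longlonglongrightarrow> f z" for f F B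
    proof -
      have "F n \<in> borel_measurable torus" for n
        using F[of n] by (simp add: square_integrable_def)
      moreover have "cmod (F n z) \<le> cmod (of_real B)" if "z \<in> space torus" for n z
        using B[OF that, of n] by simp
      ultimately have "square_integrable f" "(\<lambda>n. abs_L2 (F n)) \<longlonglongrightarrow> abs_L2 f"
        using abs_L2_tendsto[OF f _ const[of "of_real B"] _ lim] by blast+
      moreover have "abs_L2 f \<in> S"
        by (rule closed_sequentially[OF S(1) _ calculation(2)]) (use F in blast)
      ultimately show ?thesis by simp
    qed
  qed
  obtain f where f: "square_integrable f" "F = abs_L2 f"
    by (rule abs_L2_cases)
  have fm [measurable]: "f \<in> borel_measurable torus"
    using f(1) by (simp add: square_integrable_def)
  \<comment> \<open>Truncation at height \<open>n\<close>: dominated by \<open>f\<close> itself and,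
    at each point, equal to \<open>f\<close> for large \<open>n\<close>.\<close>
  define G where "G = (\<lambda>(n::nat) z. if cmod (f z) \<le> real n then f z else 0)"
  have Gm: "G n \<in> borel_measurable torus" for n
    unfolding G_def by measurable
  have "G n \<in> {f. square_integrable f \<and> abs_L2 f \<in> S}" for n
    by (rule bounded_measurable[OF Gm, where B = "real n"]) (simp add: G_def)
  then have G: "abs_L2 (G n) \<in> S" for n
    by blast
  have "(\<lambda>n. G n z) \<longlonglongrightarrow> f z" for z
  proof (rule tendsto_eventually)
    obtain N :: nat where "cmod (f z) \<le> real N"
      using real_arch_simple by blast
    then show "eventually (\<lambda>n. G n z = f z) sequentially"
      by (intro eventually_sequentiallyI[of N]) (simp add: G_def)
  qed
  then have "(\<lambda>n. abs_L2 (G n)) \<longlonglongrightarrow> F"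
    unfolding f(2) by (intro abs_L2_tendsto(2)[OF fm Gm f(1)]) (auto simp: G_def)
  then show ?thesis
    by (rule closed_sequentially[OF S(1) G])
qed

text \<open>The set where both operators agree is a closed complex subspace containing the
  monomials. This is the uniqueness half of the description in \<open>V_operator\<close>.\<close>

lemma bounded_operator_eqI:
  assumes T: "bounded_operator T" and T': "bounded_operator T'"
    and eq: "\<And>m. T (monomial m) = T' (monomial m)"
  shows "T = T'"
proof
  fix F
  have lin: "bounded_linear T" "bounded_linear T'"
    and sc: "\<And>c F. T (scaleC c F) = scaleC c (T F)" "\<And>c F. T' (scaleC c F) = scaleC c (T' F)"
    using T T' by (auto simp: bounded_operator_def)
  interpret T: bounded_linear T by (rule lin)
  interpret T': bounded_linear T' by (rule lin)
  have "closed {F. T F = T' F}"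
    by (intro closed_Collect_eq linear_continuous_on lin)
  then have "F \<in> {F. T F = T' F}"
    by (rule monomials_dense) (simp_all add: eq sc T.add T'.add)
  then show "T F = T' F"
    by simp
qed

lemma bounded_linear_cinner_left: "bounded_linear (\<lambda>F. cinner F G)"
proof (rule bounded_linear_intro)
  fix F
  \<comment> \<open>Rotating \<open>F\<close> by this phase makes the inner product real and
    nonnegative, which reduces the estimate to the real Cauchy--Schwarz inequality. If the product
    is 0, so is \<open>c\<close>.\<close>
  define c where "c = cnj (sgn (cinner F G))"
  have "c * cinner F G = of_real (cmod (cinner F G))"
    by (simp add: c_def sgn_div_norm scaleR_conv_of_real mult.commute[of "cnj _"] divide_simps
        flip: complex_norm_square) (simp add: complex_norm_square power2_eq_square)
  then have "cmod (cinner F G) = inner (scaleC c F) G"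
    by (simp add: inner_L2_def cinner_scaleC_left)
  also have "\<dots> \<le> norm (scaleC c F) * norm G"
    by (rule norm_cauchy_schwarz)
  also have "\<dots> \<le> norm F * norm G"
    by (intro mult_right_mono) (auto simp: norm_scaleC c_def norm_sgn)
  finally show "norm (cinner F G) \<le> norm F * norm G" .
qed (simp_all add: cinner_add_left scaleR_eq_scaleC cinner_scaleC_left scaleR_conv_of_real)

text \<open>Completeness of the monomials: the vectors orthogonal to \<open>F - G\<close> form a
  closed complex subspace that contains them all.\<close>

lemma cinner_monomial_eqI:
  assumes "\<And>m. cinner F (monomial m) = cinner G (monomial m)"
  shows "F = G"
proof (rule cinner_eqI)
  fix H
  have *: "bounded_linear (\<lambda>H. cinner H (F - G))"
    by (rule bounded_linear_cinner_left)
  have orth: "cinner (monomial m) (F - G) = 0" for m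
    by (simp add: cinner_commute[of "monomial m"] cinner_diff_left assms)
  have "closed {H. cinner H (F - G) = 0}"
    by (intro closed_Collect_eq linear_continuous_on[OF *] continuous_on_const)
  then have "H \<in> {H. cinner H (F - G) = 0}"
    by (rule monomials_dense) (simp_all add: orth cinner_add_left cinner_scaleC_left)
  then show "cinner F H = cinner G H"
    by (simp add: cinner_commute[of H] cinner_diff_left)
qed

lemma cinner_monomial: "cinner (monomial m) (monomial l) = (if m = l then 1 else 0)"
proof -
  have "cinner (monomial m) (monomial l) = (\<integral>z. character m z * cnj (character l z) \<partial>torus)"
    by (simp add: monomial_eq cinner_abs_L2 square_integrable_character)
  also have "\<dots> = (\<integral>z. character (\<lambda>i. m i - l i) z \<partial>torus)"
    by (intro Bochner_Integration.integral_cong refl)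
       (use character_add[of _ m "\<lambda>i. - l i"] in \<open>simp add: cnj_character\<close>)
  also have "\<dots> = (if m = l then 1 else 0)"
    by (auto simp: integral_character fun_eq_iff)
  finally show ?thesis .
qed

section \<open>Adjoints, multiplication operators and pullbacks\<close>

text \<open>Inner products determine the values of an adjoint, so an explicit bounded candidate
  settles the definite description.\<close>

lemma adjoint_operator_eqI:
  assumes "bounded_operator T'" "\<And>F G. cinner (T F) G = cinner F (T' G)"
  shows "adjoint_operator T = T'"
  unfolding adjoint_operator_def
proof (rule the_equality)
  fix U assume U: "bounded_operator U \<and> (\<forall>f g. cinner (T f) g = cinner f (U g))"
  show "U = T'"
  proof
    fix G
    have "cinner (U G) F = cinner (T' G) F" for F
    proof -
      have "cinner F (U G) = cinner F (T' G)"
        using U assms(2) by metis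
      then show ?thesis
        by (metis cinner_commute)
    qed
    then show "U G = T' G"
      by (rule cinner_eqI)
  qed
qed (use assms in auto)

section \<open>Multiplication operators and Fourier coefficients\<close>

lift_definition cnj_Linf :: "'n::finite Linf \<Rightarrow> 'n Linf" is "\<lambda>p z. cnj (p z)"
proof -
  fix f g :: "('n \<Rightarrow> complex) \<Rightarrow> complex"
  assume "essentially_bounded f \<and> essentially_bounded g \<and> (AE z in torus. f z = g z)"
  then show "essentially_bounded (\<lambda>z. cnj (f z)) \<and> essentially_bounded (\<lambda>z. cnj (g z)) \<and>
      (AE z in torus. cnj (f z) = cnj (g z))"
    by (auto simp: essentially_bounded_def intro!: borel_measurable_continuous_on[of cnj] continuous_intros)
qed

lemma cinner_mult_operator:
  "cinner (mult_operator p F) G = cinner F (mult_operator (cnj_Linf p) G)"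
  by transfer (simp add: mult_ac)

lemma abs_Linf_cases:
  obtains p where "essentially_bounded p" "\<phi> = abs_Linf p"
  using Quotient_rep_reflp[OF Quotient_Linf, of \<phi>] Quotient_abs_rep[OF Quotient_Linf, of \<phi>] by metis

lemma mult_operator_abs:
  "essentially_bounded p \<Longrightarrow> square_integrable f \<Longrightarrow>
    mult_operator (abs_Linf p) (abs_L2 f) = abs_L2 (\<lambda>z. p z * f z)"
  by (intro mult_operator.abs_eq) auto

lemma bounded_operator_mult_operator: "bounded_operator (mult_operator \<phi>)"
proof (cases \<phi> rule: abs_Linf_cases)
  fix p assume p: "essentially_bounded p" "\<phi> = abs_Linf p"
  then obtain C where C: "AE z in torus. cmod (p z) \<le> C"
    by (auto simp: essentially_bounded_def)
  show ?thesis
  proof (rule bounded_operatorI)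
    \<comment> \<open>Moving the operator to the second argument turns linearity of the operator
      into linearity of \<open>cinner\<close>.\<close>
    show "mult_operator \<phi> (F + G) = mult_operator \<phi> F + mult_operator \<phi> G" for F G
      by (rule cinner_eqI) (simp add: cinner_mult_operator cinner_add_left)
    show "mult_operator \<phi> (scaleC c F) = scaleC c (mult_operator \<phi> F)" for c F
      by (rule cinner_eqI) (simp add: cinner_mult_operator cinner_scaleC_left)
    show "norm (mult_operator \<phi> F) \<le> max C 0 * norm F" for F
    proof (cases F rule: abs_L2_cases)
      fix f assume f: "square_integrable f" "F = abs_L2 f"
      have pf: "square_integrable (\<lambda>z. p z * f z)"
        by (rule square_integrable_mult[OF p(1) f(1)])
      have "(norm (mult_operator \<phi> F))\<^sup>2 = (\<integral>z. (cmod (p z * f z))\<^sup>2 \<partial>torus)"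
        by (simp add: p f mult_operator_abs norm_abs_L2 pf)
      also have "\<dots> \<le> (\<integral>z. (max C 0)\<^sup>2 * (cmod (f z))\<^sup>2 \<partial>torus)"
      proof (rule integral_mono_AE)
        show "AE z in torus. (cmod (p z * f z))\<^sup>2 \<le> (max C 0)\<^sup>2 * (cmod (f z))\<^sup>2"
          using C
        proof eventually_elim
          case (elim z)
          then have "(cmod (p z))\<^sup>2 \<le> (max C 0)\<^sup>2"
            by (intro power_mono) auto
          then show ?case
            by (simp add: norm_mult power_mult_distrib mult_right_mono)
        qed
      qed (use pf f(1) in \<open>auto simp: square_integrable_def\<close>)
      also have "\<dots> = (max C 0 * norm F)\<^sup>2"
        by (simp add: f norm_abs_L2 power_mult_distrib)
      finally show ?thesis
        by (rule power2_le_imp_le) simp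
    qed
  qed
qed

lemma mult_operator_zero: "mult_operator 0 F = 0"
  by transfer (auto simp: square_integrable_zero)

text \<open>Characters are unimodular on the torus, so both sides are the L^2 norm of \<phi>. This
  evaluates the adjoint of the slant operator on monomials.\<close>

lemma norm_mult_operator_monomial:
  "norm (mult_operator (cnj_Linf \<phi>) (monomial m)) = norm (mult_operator \<phi> (monomial l))"
proof (cases \<phi> rule: abs_Linf_cases)
  fix p assume p: "essentially_bounded p" "\<phi> = abs_Linf p"
  have cp: "essentially_bounded (\<lambda>z. cnj (p z))" "cnj_Linf \<phi> = abs_Linf (\<lambda>z. cnj (p z))"
    using p by (auto simp: essentially_bounded_def cnj_Linf.abs_eq
        intro!: borel_measurable_continuous_on[of cnj] continuous_intros)
  have "(\<integral>z. (cmod (cnj (p z) * character m z))\<^sup>2 \<partial>torus) = (\<integral>z. (cmod (p z * character l z))\<^sup>2 \<partial>torus)"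
    by (intro Bochner_Integration.integral_cong refl) (simp add: norm_mult norm_character)
  then have "(norm (mult_operator (cnj_Linf \<phi>) (monomial m)))\<^sup>2 = (norm (mult_operator \<phi> (monomial l)))\<^sup>2"
    using p(1) cp(1)
    by (simp add: p(2) cp(2)[unfolded p(2)] monomial_eq mult_operator_abs square_integrable_character
        norm_abs_L2 square_integrable_mult)
  then show ?thesis by simp
qed

text \<open>On the torus the characters of \<open>m\<close> and \<open>- l\<close> multiply to that
  of \<open>m - l\<close>, so every matrix entry is a Fourier coefficient of \<phi>.\<close>

lemma cinner_mult_operator_monomial:
  "cinner (mult_operator \<phi> (monomial m)) (monomial l) =
    cinner (mult_operator \<phi> (monomial (\<lambda>_. 0))) (monomial (\<lambda>i. l i - m i))"
proof (cases \<phi> rule: abs_Linf_cases)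
  fix p assume p: "essentially_bounded p" "\<phi> = abs_Linf p"
  have "p z * character m z * cnj (character l z) = p z * character (\<lambda>_. 0) z * cnj (character (\<lambda>i. l i - m i) z)"
    if z: "z \<in> space torus" for z
    using character_add[OF z, of m "\<lambda>i. - l i"] by (simp add: cnj_character z)
  then have "(\<integral>z. p z * character m z * cnj (character l z) \<partial>torus) =
      (\<integral>z. p z * character (\<lambda>_. 0) z * cnj (character (\<lambda>i. l i - m i) z) \<partial>torus)"
    by (intro Bochner_Integration.integral_cong refl)
  then show ?thesis
    using p(1)
    by (simp add: p(2) monomial_eq mult_operator_abs square_integrable_character cinner_abs_L2
        square_integrable_mult del: character_zero)
qed

text \<open>The product with the constant 1 is \<phi> itself, and both quotients identify functions
  almost everywhere.\<close>

lemma mult_operator_one_eq_zero: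
  assumes "mult_operator \<phi> (monomial (\<lambda>_. 0)) = 0"
  shows "\<phi> = 0"
  using assms by transfer (auto simp: essentially_bounded_zero)

section \<open>Pullbacks along measure-preserving maps\<close>

definition pullback :: "(('n::finite \<Rightarrow> complex) \<Rightarrow> 'n \<Rightarrow> complex) \<Rightarrow> 'n L2 \<Rightarrow> 'n L2" where
  "pullback \<tau> F = abs_L2 (\<lambda>z. rep_L2 F (\<tau> z))"

lemma torus_preserving_measurable: "torus_preserving \<tau> \<Longrightarrow> \<tau> \<in> measurable torus torus"
  by (simp add: torus_preserving_def)

lemma torus_preserving_distr: "torus_preserving \<tau> \<Longrightarrow> distr torus torus \<tau> = torus"
  by (simp add: torus_preserving_def)

lemma torus_preserving_integral:
  fixes f :: "_ \<Rightarrow> 'b::{banach, second_countable_topology}"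
  assumes "torus_preserving \<tau>" "f \<in> borel_measurable torus"
  shows "(\<integral>z. f (\<tau> z) \<partial>torus) = (\<integral>z. f z \<partial>torus)"
  using integral_distr[OF torus_preserving_measurable[OF assms(1)] assms(2)]
  by (simp add: torus_preserving_distr assms(1))

lemma torus_preserving_integrable:
  fixes f :: "_ \<Rightarrow> 'b::{banach, second_countable_topology}"
  assumes "torus_preserving \<tau>" "f \<in> borel_measurable torus"
  shows "integrable torus (\<lambda>z. f (\<tau> z)) \<longleftrightarrow> integrable torus f"
  using integrable_distr_eq[OF torus_preserving_measurable[OF assms(1)] assms(2)]
  by (simp add: torus_preserving_distr assms(1))

lemma torus_preserving_AE:
  assumes "torus_preserving \<tau>" "AE z in torus. P z"
  shows "AE z in torus. P (\<tau> z)"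
  by (rule AE_distrD[OF torus_preserving_measurable[OF assms(1)]])
     (subst torus_preserving_distr[OF assms(1)], rule assms(2))

text \<open>The integral of \<open>(cmod (f z))\<^sup>2\<close> is invariant under \<tau>. The
  implication from the composition to \<open>f\<close> is what makes the slant operator land in
  L^2.\<close>

lemma square_integrable_compose:
  assumes \<tau>: "torus_preserving \<tau>" and f: "f \<in> borel_measurable torus"
  shows "square_integrable (\<lambda>z. f (\<tau> z)) \<longleftrightarrow> square_integrable f"
proof -
  have "(\<lambda>z. f (\<tau> z)) \<in> borel_measurable torus"
    using measurable_compose[OF torus_preserving_measurable[OF \<tau>] f] .
  moreover have "(\<lambda>z. (cmod (f z))\<^sup>2) \<in> borel_measurable torus"
    using f by measurable
  ultimately show ?thesis
    using torus_preserving_integrable[OF \<tau>, of "\<lambda>z. (cmod (f z))\<^sup>2"] f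
    by (simp add: square_integrable_def)
qed

lemma square_integrable_pullback:
  "torus_preserving \<tau> \<Longrightarrow> square_integrable f \<Longrightarrow> square_integrable (\<lambda>z. f (\<tau> z))"
  by (subst square_integrable_compose) (auto simp: square_integrable_def)

text \<open>Null sets pull back to null sets, so the representative chosen in the definition may be
  replaced by any other.\<close>

lemma pullback_abs_L2:
  assumes "torus_preserving \<tau>" "square_integrable f"
  shows "pullback \<tau> (abs_L2 f) = abs_L2 (\<lambda>z. f (\<tau> z))"
  unfolding pullback_def
  using torus_preserving_AE[OF assms(1) rep_abs_L2[OF assms(2)]]
  by (simp add: abs_L2_eq_iff square_integrable_pullback assms square_integrable_rep_L2)

lemma cinner_pullback:
  assumes "torus_preserving \<tau>"
  shows "cinner (pullback \<tau> F) (pullback \<tau> G) = cinner F G"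
proof (cases F rule: abs_L2_cases, cases G rule: abs_L2_cases)
  fix f g assume fg: "square_integrable f" "F = abs_L2 f" "square_integrable g" "G = abs_L2 g"
  have "(\<integral>z. f (\<tau> z) * cnj (g (\<tau> z)) \<partial>torus) = (\<integral>z. f z * cnj (g z) \<partial>torus)"
    by (rule torus_preserving_integral[OF assms borel_measurable_integrable[OF integrable_mult_cnj]])
       (use fg in auto)
  then show ?thesis
    using fg assms by (simp add: pullback_abs_L2 cinner_abs_L2 square_integrable_pullback)
qed

lemma norm_pullback: "torus_preserving \<tau> \<Longrightarrow> norm (pullback \<tau> F) = norm F"
  by (simp add: norm_L2_def cinner_pullback)

lemma bounded_operator_pullback:
  assumes \<tau>: "torus_preserving \<tau>"
  shows "bounded_operator (pullback \<tau>)"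
proof (rule bounded_operatorI)
  show "pullback \<tau> (F + G) = pullback \<tau> F + pullback \<tau> G" for F G
    by (cases F rule: abs_L2_cases, cases G rule: abs_L2_cases)
       (simp add: abs_L2_add pullback_abs_L2 \<tau> square_integrable_add square_integrable_pullback)
  show "pullback \<tau> (scaleC c F) = scaleC c (pullback \<tau> F)" for c F
    by (cases F rule: abs_L2_cases)
       (simp add: abs_L2_scaleC pullback_abs_L2 \<tau> square_integrable_cmult square_integrable_pullback)
  show "norm (pullback \<tau> F) \<le> 1 * norm F" for F
    by (simp add: norm_pullback \<tau>)
qed

section \<open>The slant operator\<close>

definition inverse_power :: "nat \<Rightarrow> ('n::finite \<Rightarrow> complex) \<Rightarrow> 'n \<Rightarrow> complex" where
  "inverse_power k z = (\<lambda>i. inverse (z i ^ k))"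

text \<open>For positive \<open>k\<close>, a measurable right inverse of
  \<open>inverse_power k\<close> on the torus, built from the principal logarithm.\<close>

definition inverse_root :: "nat \<Rightarrow> ('n::finite \<Rightarrow> complex) \<Rightarrow> 'n \<Rightarrow> complex" where
  "inverse_root k z = (\<lambda>i. exp (- Ln (z i) / of_nat k))"

definition unity_roots :: "nat \<Rightarrow> ('n::finite \<Rightarrow> complex) set" where
  "unity_roots k = {\<zeta>. \<forall>i. \<zeta> i ^ k = 1}"

text \<open>On the torus and for positive \<open>k\<close>, the points
  \<open>\<lambda>i. \<zeta> i * z i\<close> run through the fibre of \<open>inverse_power k\<close>
  that contains \<open>z\<close>.\<close>

definition fibre_average :: "nat \<Rightarrow> (('n::finite \<Rightarrow> complex) \<Rightarrow> complex) \<Rightarrow> ('n \<Rightarrow> complex) \<Rightarrow> complex" where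
  "fibre_average k f z = (\<Sum>\<zeta>\<in>unity_roots k. f (\<lambda>i. \<zeta> i * z i)) / of_nat (card (unity_roots k :: ('n \<Rightarrow> complex) set))"

definition slant_reflection :: "nat \<Rightarrow> 'n::finite L2 \<Rightarrow> 'n L2" where
  "slant_reflection k F = abs_L2 (\<lambda>z. fibre_average k (rep_L2 F) (inverse_root k z))"

lemma character_inverse_power: "character m (inverse_power k z) = character (\<lambda>i. - (int k * m i)) z"
  by (simp add: character_def inverse_power_def power_int_minus power_int_inverse power_int_mult)

lemma character_mult: "character m (\<lambda>i. \<zeta> i * z i) = character m \<zeta> * character m z"
  by (simp add: character_def power_int_mult_distrib prod.distrib)

lemma norm_unity_root:
  assumes "\<zeta> \<in> unity_roots k" "k > 0"
  shows "cmod (\<zeta> i) = 1"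
  using power_eq_1_iff[of "\<zeta> i" k] assms by (auto simp: unity_roots_def)

lemma inverse_power_unity_root:
  "\<zeta> \<in> unity_roots k \<Longrightarrow> inverse_power k (\<lambda>i. \<zeta> i * z i) = inverse_power k z"
  by (simp add: inverse_power_def unity_roots_def power_mult_distrib)

lemma finite_unity_roots:
  assumes "k > 0"
  shows "finite (unity_roots k :: ('n::finite \<Rightarrow> complex) set)"
proof -
  have "finite (PiE (UNIV :: 'n set) (\<lambda>_. {z :: complex. z ^ k = 1}))"
    using assms by (intro finite_PiE finite_roots_unity) auto
  moreover have "PiE (UNIV :: 'n set) (\<lambda>_. {z :: complex. z ^ k = 1}) = unity_roots k"
    by (auto simp: unity_roots_def PiE_def)
  ultimately show ?thesis by simp
qed

lemma card_unity_roots_pos: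
  "k > 0 \<Longrightarrow> card (unity_roots k :: ('n::finite \<Rightarrow> complex) set) > 0"
  unfolding card_gt_0_iff
  by (intro conjI finite_unity_roots) (auto simp: unity_roots_def intro!: exI[of _ "\<lambda>_. 1"])

text \<open>The character of \<open>m\<close> becomes that of \<open>- k * m\<close>, and for
  positive \<open>k\<close> this exponent vanishes exactly when \<open>m\<close> does.\<close>

lemma torus_preserving_inverse_power:
  assumes "k > 0"
  shows "torus_preserving (inverse_power k :: ('n::finite \<Rightarrow> complex) \<Rightarrow> _)"
proof (rule torus_preservingI)
  show "(inverse_power k :: ('n \<Rightarrow> complex) \<Rightarrow> _) \<in> measurable torus torus"
    by (rule measurable_into_torus) (auto simp: inverse_power_def norm_inverse norm_power norm_torus)
  show "(\<integral>z. character m (inverse_power k z) \<partial>torus) = (\<integral>z. character m z \<partial>torus)" for m :: "'n \<Rightarrow> int"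
    using assms by (auto simp: character_inverse_power integral_character fun_eq_iff)
qed

text \<open>The rotation multiplies the character of \<open>m\<close> by the constant
  \<open>character m \<zeta>\<close>, which is 1 for \<open>m = 0\<close>; for other
  \<open>m\<close> both integrals vanish.\<close>

lemma torus_preserving_unity_root:
  fixes \<zeta> :: "'n::finite \<Rightarrow> complex"
  assumes "k > 0" "\<zeta> \<in> unity_roots k"
  shows "torus_preserving (\<lambda>z i. \<zeta> i * z i)"
proof (rule torus_preservingI)
  show "(\<lambda>z i. \<zeta> i * z i) \<in> measurable torus torus"
    by (rule measurable_into_torus) (auto simp: norm_mult norm_torus norm_unity_root[OF assms(2,1)])
  show "(\<integral>z. character m (\<lambda>i. \<zeta> i * z i) \<partial>torus) = (\<integral>z. character m z \<partial>torus)" for m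
    by (simp add: character_mult integral_character)
qed

lemma inverse_root:
  assumes "k > 0" "z \<in> space torus"
  shows "inverse_root k z i ^ k = inverse (z i)"
proof -
  have "inverse_root k z i ^ k = exp (of_nat k * (- Ln (z i) / of_nat k))"
    by (simp only: inverse_root_def exp_of_nat_mult)
  then show ?thesis
    using assms by (simp add: exp_minus torus_nonzero)
qed

lemma inverse_root_measurable:
  assumes "k > 0"
  shows "inverse_root k \<in> measurable torus torus"
proof (rule measurable_into_torus)
  show "(\<lambda>z. inverse_root k z i) \<in> borel_measurable torus" for i
    unfolding inverse_root_def by measurable
  show "cmod (inverse_root k z i) = 1" if "z \<in> space torus" for z i
  proof (rule power_eq_imp_eq_base)
    show "cmod (inverse_root k z i) ^ k = 1 ^ k"
      using inverse_root[OF assms that, of i] that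
      by (simp add: norm_inverse norm_torus flip: norm_power)
  qed (use assms in auto)
qed

text \<open>
  Two \<open>k\<close>-th roots differ by a root of unity, so the average over the fibre does not depend on
  the choice of the root.
\<close>

lemma fibre_average_inverse_root:
  fixes z :: "'n::finite \<Rightarrow> complex"
  assumes "k > 0" "z \<in> space torus"
  shows "fibre_average k f (inverse_root k (inverse_power k z)) = fibre_average k f z"
proof -
  let ?w = "inverse_root k (inverse_power k z)"
  define \<eta> where "\<eta> i = ?w i / z i" for i
  have "inverse_power k z \<in> space torus"
    using measurable_space[OF torus_preserving_measurable[OF torus_preserving_inverse_power[OF assms(1)]] assms(2)] .
  then have w: "?w i ^ k = z i ^ k" for i
    using inverse_root[OF assms(1), of "inverse_power k z" i] by (simp add: inverse_power_def)
  have nz: "z i \<noteq> 0" for i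
    by (rule torus_nonzero[OF assms(2)])
  have w_eq: "?w i = \<eta> i * z i" for i
    by (simp add: \<eta>_def nz)
  have \<eta>: "\<eta> i ^ k = 1" for i
    by (simp add: \<eta>_def power_divide w nz)
  then have \<eta>_nz: "\<eta> i \<noteq> 0" for i
    using assms(1) by (metis power_0_left neq0_conv zero_neq_one)
  have "(\<Sum>\<zeta>\<in>unity_roots k. f (\<lambda>i. \<zeta> i * ?w i)) = (\<Sum>\<zeta>\<in>unity_roots k. f (\<lambda>i. \<zeta> i * z i))"
    by (rule sum.reindex_bij_witness[where i = "\<lambda>\<zeta> i. \<zeta> i / \<eta> i" and j = "\<lambda>\<zeta> i. \<zeta> i * \<eta> i"])
       (auto simp: unity_roots_def power_mult_distrib power_divide \<eta> \<eta>_nz w_eq mult.assoc)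
  then show ?thesis
    by (simp add: fibre_average_def)
qed

context
  fixes k :: nat
  assumes k: "k > 0"
begin

lemma square_integrable_fibre_average:
  assumes f: "square_integrable (f :: ('n::finite \<Rightarrow> complex) \<Rightarrow> complex)"
  shows "square_integrable (fibre_average k f)"
proof -
  have rot: "square_integrable (\<lambda>z. f (\<lambda>i. \<zeta> i * z i))" if "\<zeta> \<in> unity_roots k" for \<zeta> :: "'n \<Rightarrow> complex"
    by (rule square_integrable_pullback[OF torus_preserving_unity_root[OF k that] f])
  have sum: "square_integrable (\<lambda>z. \<Sum>\<zeta>\<in>I. f (\<lambda>i. \<zeta> i * z i))"
    if "finite I" "I \<subseteq> unity_roots k" for I :: "('n \<Rightarrow> complex) set"
    using that
    by (induction I rule: finite_induct)
       (auto intro: square_integrable_zero square_integrable_add rot)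
  have "square_integrable (\<lambda>z. inverse (of_nat (card (unity_roots k :: ('n \<Rightarrow> complex) set)))
      * (\<Sum>\<zeta>\<in>unity_roots k. f (\<lambda>i. \<zeta> i * z i)))"
    by (intro square_integrable_cmult sum finite_unity_roots k order_refl)
  then show ?thesis
    by (simp add: fibre_average_def[abs_def] divide_inverse mult.commute)
qed

lemma square_integrable_cong:
  assumes "\<And>z. z \<in> space torus \<Longrightarrow> f z = g z"
  shows "square_integrable f \<longleftrightarrow> square_integrable g"
  unfolding square_integrable_def
  using assms by (intro conj_cong measurable_cong Bochner_Integration.integrable_cong) auto

text \<open>\<open>inverse_root k\<close> need not preserve the measure, so the claim is tested
  after composing with \<open>inverse_power k\<close>, where the function becomes the fibre average
  itself.\<close>

lemma square_integrable_slant: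
  assumes f: "square_integrable (f :: ('n::finite \<Rightarrow> complex) \<Rightarrow> complex)"
  shows "square_integrable (\<lambda>z. fibre_average k f (inverse_root k z))" (is "square_integrable ?g")
proof -
  have "fibre_average k f \<in> borel_measurable torus"
    using square_integrable_fibre_average[OF f] by (simp add: square_integrable_def)
  then have "?g \<in> borel_measurable torus"
    by (rule measurable_compose[OF inverse_root_measurable[OF k]])
  then have "square_integrable ?g \<longleftrightarrow> square_integrable (\<lambda>z. ?g (inverse_power k z))"
    by (rule square_integrable_compose[OF torus_preserving_inverse_power[OF k], symmetric])
  also have "\<dots> \<longleftrightarrow> square_integrable (fibre_average k f)"
    by (rule square_integrable_cong) (rule fibre_average_inverse_root[OF k])
  finally show ?thesis
    using square_integrable_fibre_average[OF f] by simp
qed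

text \<open>Substituting \<open>inverse_power k\<close> for the variable removes the chosen root and
  leaves a fibre average against a function that is constant on fibres; by rotation invariance all
  summands have the same integral.\<close>

lemma cinner_slant_reflection:
  "cinner (slant_reflection k F) G = cinner F (pullback (inverse_power k) G)"
proof (cases G rule: abs_L2_cases)
  fix g assume g: "square_integrable g" "G = abs_L2 g"
  let ?R = "unity_roots k :: ('a \<Rightarrow> complex) set"
  let ?f = "rep_L2 F" and ?p = "inverse_power k"
  let ?c = "of_nat (card ?R) :: complex"
  have p: "torus_preserving (?p :: ('a \<Rightarrow> complex) \<Rightarrow> _)"
    by (rule torus_preserving_inverse_power[OF k])
  note f = square_integrable_rep_L2[of F]
  note Vf = square_integrable_slant[OF f]
  have gp: "square_integrable (\<lambda>z. g (?p z))"
    by (rule square_integrable_pullback[OF p g(1)])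
  have int: "integrable torus (\<lambda>z. ?f z * cnj (g (?p z)))"
    by (rule integrable_mult_cnj[OF f gp])
  \<comment> \<open>The factor \<open>g (?p z)\<close> is unchanged by rotation with a root of
    unity, so invariance of the measure applies to the whole product.\<close>
  have rot: "integrable torus (\<lambda>z. ?f (\<lambda>i. \<zeta> i * z i) * cnj (g (?p z)))"
    "(\<integral>z. ?f (\<lambda>i. \<zeta> i * z i) * cnj (g (?p z)) \<partial>torus) = (\<integral>z. ?f z * cnj (g (?p z)) \<partial>torus)"
    if \<zeta>: "\<zeta> \<in> ?R" for \<zeta>
    using torus_preserving_integrable[OF torus_preserving_unity_root[OF k \<zeta>] borel_measurable_integrable[OF int]]
      torus_preserving_integral[OF torus_preserving_unity_root[OF k \<zeta>] borel_measurable_integrable[OF int]] int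
    by (simp_all add: inverse_power_unity_root[OF \<zeta>])
  have "cinner (slant_reflection k F) G = (\<integral>z. fibre_average k ?f (inverse_root k z) * cnj (g z) \<partial>torus)"
    by (simp add: slant_reflection_def g(2) cinner_abs_L2 Vf g(1))
  also have "\<dots> = (\<integral>z. fibre_average k ?f (inverse_root k (?p z)) * cnj (g (?p z)) \<partial>torus)"
    by (rule torus_preserving_integral[OF p borel_measurable_integrable[OF integrable_mult_cnj[OF Vf g(1)]], symmetric])
  also have "\<dots> = (\<integral>z. (\<Sum>\<zeta>\<in>?R. ?f (\<lambda>i. \<zeta> i * z i) * cnj (g (?p z))) / ?c \<partial>torus)"
    by (intro Bochner_Integration.integral_cong refl)
       (simp add: fibre_average_inverse_root[OF k], simp add: fibre_average_def sum_distrib_right)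
  also have "\<dots> = (\<Sum>\<zeta>\<in>?R. \<integral>z. ?f (\<lambda>i. \<zeta> i * z i) * cnj (g (?p z)) \<partial>torus) / ?c"
    by (simp add: Bochner_Integration.integral_sum rot(1))
  also have "\<dots> = (\<integral>z. ?f z * cnj (g (?p z)) \<partial>torus)"
    using card_unity_roots_pos[OF k, where 'n = 'a] by (simp add: rot(2))
  also have "\<dots> = cinner F (pullback ?p G)"
    by (simp add: g(2) pullback_abs_L2[OF p g(1)] abs_rep_L2 flip: cinner_abs_L2[OF f gp])
  finally show ?thesis .
qed

text \<open>By the adjoint relation the squared norm of the image is the inner product of
  \<open>F\<close> with an isometric copy of that image; Cauchy--Schwarz and cancelling one factor
  give the bound 1.\<close>

lemma bounded_operator_slant_reflection: "bounded_operator (slant_reflection k :: 'n::finite L2 \<Rightarrow> _)"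
proof (rule bounded_operatorI)
  fix F G :: "'n L2" and c
  show "slant_reflection k (F + G) = slant_reflection k F + slant_reflection k G"
    by (rule cinner_eqI) (simp add: cinner_slant_reflection cinner_add_left)
  show "slant_reflection k (scaleC c F) = scaleC c (slant_reflection k F)"
    by (rule cinner_eqI) (simp add: cinner_slant_reflection cinner_scaleC_left)
  let ?V = "slant_reflection k F"
  have "(norm ?V)\<^sup>2 = inner F (pullback (inverse_power k) ?V)"
    by (simp add: power2_norm_eq_inner inner_L2_def cinner_slant_reflection)
  also have "\<dots> \<le> norm F * norm (pullback (inverse_power k) ?V)"
    by (rule norm_cauchy_schwarz)
  also have "\<dots> = norm F * norm ?V"
    by (simp add: norm_pullback torus_preserving_inverse_power k)
  finally show "norm ?V \<le> 1 * norm F"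
    by (cases "norm ?V = 0") (simp_all add: power2_eq_square)
qed

lemma pullback_inverse_power_monomial:
  "pullback (inverse_power k) (monomial m) = monomial (\<lambda>i. - (int k * m i))"
  by (simp add: monomial_eq pullback_abs_L2 torus_preserving_inverse_power k
      square_integrable_character character_inverse_power[abs_def])

text \<open>Coefficients are compared: pairing with the monomial of \<open>l\<close> turns it into
  that of \<open>- k * l\<close>, and orthonormality leaves the equation
  \<open>m = - k * l\<close>.\<close>

lemma slant_reflection_monomial:
  fixes m :: "'n::finite \<Rightarrow> int"
  shows "slant_reflection k (monomial m) =
    (if \<forall>i. int k dvd m i then monomial (\<lambda>i. - (m i div int k)) else 0)"
proof (rule cinner_monomial_eqI)
  fix l :: "'n \<Rightarrow> int"
  \<comment> \<open>Solvability for \<open>l\<close> is divisibility by \<open>k\<close>, and the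
    solution is unique since \<open>k\<close> is positive.\<close>
  have "(m = (\<lambda>i. - (int k * l i))) \<longleftrightarrow> (\<forall>i. int k dvd m i) \<and> (\<lambda>i. - (m i div int k)) = l"
  proof -
    have "x = - (int k * y) \<longleftrightarrow> int k dvd x \<and> - (x div int k) = y" for x y
    proof
      assume "x = - (int k * y)"
      then have "x = int k * (- y)"
        by simp
      then show "int k dvd x \<and> - (x div int k) = y"
        using k by (simp only: dvd_triv_left nonzero_mult_div_cancel_left) simp
    qed auto
    then show ?thesis
      by (auto simp: fun_eq_iff)
  qed
  then show "cinner (slant_reflection k (monomial m)) (monomial l) =
    cinner (if \<forall>i. int k dvd m i then monomial (\<lambda>i. - (m i div int k)) else 0) (monomial l)"
    by (auto simp: cinner_slant_reflection pullback_inverse_power_monomial cinner_monomial)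
qed

text \<open>\<open>slant_reflection k\<close> satisfies the description, and density of the
  monomials excludes any other operator.\<close>

lemma V_operator_eq: "V_operator k = slant_reflection k"
  unfolding V_operator_def
proof (rule the_equality)
  show "T = slant_reflection k" if "bounded_operator T \<and> (\<forall>m. T (monomial m) =
      (if \<forall>i. int k dvd m i then monomial (\<lambda>i. - (m i div int k)) else 0))" for T :: "'n::finite L2 \<Rightarrow> 'n L2"
    by (rule bounded_operator_eqI)
       (simp_all add: that bounded_operator_slant_reflection slant_reflection_monomial)
qed (simp add: bounded_operator_slant_reflection slant_reflection_monomial)

text \<open>The factors are reversed: the adjoint of V is the pullback, and that of multiplication
  by \<phi> is multiplication by its conjugate.\<close>

lemma adjoint_slant_Hankel:
  fixes \<phi> :: "'n::finite Linf"
  shows "adjoint_operator (slant_Hankel k \<phi>) = (\<lambda>G. mult_operator (cnj_Linf \<phi>) (pullback (inverse_power k) G))"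
proof (rule adjoint_operator_eqI)
  have "bounded_operator (pullback (inverse_power k) :: 'n L2 \<Rightarrow> _)"
    by (rule bounded_operator_pullback[OF torus_preserving_inverse_power[OF k]])
  then show "bounded_operator (\<lambda>G. mult_operator (cnj_Linf \<phi>) (pullback (inverse_power k) G))"
    using bounded_operator_mult_operator[of "cnj_Linf \<phi>"]
    by (auto simp: bounded_operator_def intro: bounded_linear_compose)
  show "cinner (slant_Hankel k \<phi> F) G = cinner F (mult_operator (cnj_Linf \<phi>) (pullback (inverse_power k) G))" for F G
    by (simp add: slant_Hankel_def V_operator_eq cinner_slant_reflection cinner_mult_operator)
qed

text \<open>Equality in \<open>\<parallel>V u\<parallel> \<le> \<parallel>u\<parallel>\<close>, where \<open>V\<close> is a coisometry, forces \<open>u\<close> into its initial space.\<close>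

lemma slant_reflection_initial_space:
  assumes "norm F \<le> norm (slant_reflection k F)"
  shows "pullback (inverse_power k) (slant_reflection k F) = F"
proof -
  let ?V = "slant_reflection k F"
  let ?P = "pullback (inverse_power k) ?V"
  have "inner ?P ?P = (norm ?V)\<^sup>2"
    by (simp add: norm_pullback torus_preserving_inverse_power k flip: power2_norm_eq_inner)
  moreover have FP: "inner F ?P = (norm ?V)\<^sup>2"
    by (simp add: power2_norm_eq_inner inner_L2_def cinner_slant_reflection)
  \<comment> \<open>Both \<open>inner ?P ?P\<close> and \<open>inner F ?P\<close> equal the square
    of \<open>norm ?V\<close>, so the expansion collapses to a difference that the hypothesis makes
    nonpositive.\<close>
  moreover have "(norm (?P - F))\<^sup>2 = inner ?P ?P - 2 * inner F ?P + (norm F)\<^sup>2"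
    unfolding power2_norm_eq_inner inner_diff_left inner_diff_right inner_commute[of ?P F] by simp
  ultimately have "(norm (?P - F))\<^sup>2 = (norm F)\<^sup>2 - (norm ?V)\<^sup>2"
    by simp
  moreover have "(norm F)\<^sup>2 \<le> (norm ?V)\<^sup>2"
    using assms by (simp add: power_mono)
  ultimately have "(norm (?P - F))\<^sup>2 \<le> 0"
    by simp
  then show ?thesis by simp
qed

end

theorem theorem3p5:
  fixes k :: nat and \<phi> :: "'n::finite Linf"
  assumes "k \<ge> 2"
  shows "hyponormal (slant_Hankel k \<phi> :: 'n L2 \<Rightarrow> 'n L2) \<longleftrightarrow> \<phi> = 0"
proof
  have k: "k > 0"
    using assms by simp
  show "\<phi> = 0" if hyp: "hyponormal (slant_Hankel k \<phi> :: 'n L2 \<Rightarrow> 'n L2)"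
  proof (rule mult_operator_one_eq_zero, rule cinner_monomial_eqI)
    fix j :: "'n \<Rightarrow> int"
    let ?l = "\<lambda>_ :: 'n. 1 :: int" and ?m = "\<lambda>i. 1 - j i"
    let ?u = "mult_operator \<phi> (monomial ?m)"
    let ?W = "pullback (inverse_power k)" and ?V = "slant_reflection k"
    have "norm (adjoint_operator (slant_Hankel k \<phi>) (monomial ?m)) \<le> norm (slant_Hankel k \<phi> (monomial ?m))"
      using hyp by (simp add: hyponormal_def)
    \<comment> \<open>The pullback sends the monomial to another monomial, and the norm of its
      product with the conjugate of \<phi> does not depend on which one it is.\<close>
    moreover have "norm (adjoint_operator (slant_Hankel k \<phi>) (monomial ?m)) = norm ?u"
      by (simp add: adjoint_slant_Hankel[OF k] pullback_inverse_power_monomial[OF k] norm_mult_operator_monomial)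
    ultimately have u: "?W (?V ?u) = ?u"
      by (intro slant_reflection_initial_space[OF k]) (simp add: slant_Hankel_def V_operator_eq[OF k])
    \<comment> \<open>Since \<open>k\<close> is at least 2 and the index type is nonempty,
      \<open>k\<close> does not divide all entries of \<open>?l\<close>. Hence this monomial is
      orthogonal to the range of \<open>?W\<close>, which contains \<open>?u\<close>.\<close>
    have "?V (monomial ?l) = 0"
      using assms by (simp add: slant_reflection_monomial[OF k])
    then have "cinner (monomial ?l) (?W (?V ?u)) = 0"
      by (simp flip: cinner_slant_reflection[OF k])
    then have "cinner ?u (monomial ?l) = 0"
      unfolding u by (subst cinner_commute) simp
    then show "cinner (mult_operator \<phi> (monomial (\<lambda>_. 0))) (monomial j) = cinner 0 (monomial j)"
      by (simp add: cinner_mult_operator_monomial[of \<phi> ?m])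
  qed
  show "hyponormal (slant_Hankel k \<phi> :: 'n L2 \<Rightarrow> 'n L2)" if "\<phi> = 0"
  proof -
    have "slant_reflection k 0 = (0 :: 'n L2)"
      by (rule cinner_eqI) (simp add: cinner_slant_reflection[OF k])
    then have S: "slant_Hankel k \<phi> = (\<lambda>_ :: 'n L2. 0)"
      by (auto simp: slant_Hankel_def that mult_operator_zero V_operator_eq[OF k])
    have scaleC_zero: "scaleC c 0 = (0 :: 'n L2)" for c
      by (rule cinner_eqI) (simp add: cinner_scaleC_left)
    then have bounded: "bounded_operator (\<lambda>_ :: 'n L2. 0 :: 'n L2)"
      by (simp add: bounded_operator_def)
    \<comment> \<open>The adjoint is a definite description, so its value at the zero operator comes
      from the uniqueness criterion.\<close>
    then have "adjoint_operator (\<lambda>_ :: 'n L2. 0) = (\<lambda>_. 0 :: 'n L2)"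
      by (rule adjoint_operator_eqI) simp
    then show ?thesis
      by (simp add: hyponormal_def S bounded)
  qed
qed

end
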